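(* Let $\tau\in\mathcal H$ and $z_1,z_2,z_3\in\mathbb{C}\setminus L_\tau$ with $z_1+z_2+z_3=0$. Then in $\mathbb{C}[[X,Y]]$, $$\big(Tay_{z_1}\phi_1(\tau,X)+Tay_{z_2}\phi_1(\tau,Y)+Tay_{z_3}\phi_1(\tau,-X-Y)\big)^2=Tay_{z_1}\wp(\tau,X)+Tay_{z_2}\wp(\tau,Y)+Tay_{z_3}\wp(\tau,-X-Y).$$
   Context: $L_\tau=\mathbb{Z}\tau+\mathbb{Z}$, $\wp(z,\tau)$ the Weierstrass $\wp$-function of $L_\tau$. $\phi_1(z,\tau)$ is the value at $s=0$ of the analytic continuation of $\sum_{\omega\in L_\tau}{}'(z+\omega)^{-1}|z+\omega|^{-s}$ (term $\omega=-z$ omitted if $z\in L_\tau$); it is $C^\infty$ in $z$ off $L_\tau$. For a function $h(z,\tau)$ that is $C^\infty$ in $z$ and $z_0\in\mathbb{C}$, $Tay_{z_0}h(\tau,X)=\sum_{n\ge0}\frac{\partial^n h}{\partial z^n}(z_0,\tau)\frac{X^n}{n!}$, with $\partial/\partial z$ the (Wirtinger) derivative in $z$. *)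

theory Defs
  imports "HOL-Complex_Analysis.Complex_Analysis" "HOL-Computational_Algebra.Formal_Power_Series"
begin

definition period_lattice :: "complex \<Rightarrow> complex set" where
  "period_lattice \<tau> = {of_int m * \<tau> + of_int n | m n :: int. True}"

definition weierstrass_p :: "complex \<Rightarrow> complex \<Rightarrow> complex" where
  "weierstrass_p z \<tau> = 1 / z\<^sup>2 + (\<Sum>\<^sub>\<infinity>\<omega>\<in>period_lattice \<tau> - {0}. 1 / (z - \<omega>)\<^sup>2 - 1 / \<omega>\<^sup>2)"

text \<open>
  For \<open>Im \<tau> > 0\<close> the following series converges absolutely exactly for \<open>Re s > 1\<close>;
  outside that half-plane the value of the infinite sum is not used.
\<close>

definition phi1_series :: "complex \<Rightarrow> complex \<Rightarrow> complex \<Rightarrow> complex" where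
  "phi1_series z \<tau> s =
     (\<Sum>\<^sub>\<infinity>\<omega>\<in>period_lattice \<tau> - {-z}. inverse (z + \<omega>) * of_real (cmod (z + \<omega>)) powr (- s))"

definition phi1_continuation ::
    "complex \<Rightarrow> complex \<Rightarrow> real \<Rightarrow> (complex \<Rightarrow> complex) \<Rightarrow> bool" where
  "phi1_continuation z \<tau> c F \<longleftrightarrow>
     F holomorphic_on {s. Re s > c} \<and> (\<forall>s. Re s > 1 \<longrightarrow> F s = phi1_series z \<tau> s)"

definition phi1 :: "complex \<Rightarrow> complex \<Rightarrow> complex" where
  "phi1 z \<tau> = (THE v. \<exists>c F. c < 0 \<and> phi1_continuation z \<tau> c F \<and> v = F 0)"

lemma phi1_continuation_unique:
  assumes F: "phi1_continuation z \<tau> c F" "c < 0" and G: "phi1_continuation z \<tau> d G" "d < 0"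
  shows "F 0 = G 0"
proof (rule analytic_continuation_open[of "{s. Re s > 1}" "{s. Re s > max c d}" F G])
  show "open {s. Re s > 1}" "open {s. Re s > max c d}"
    by (rule open_halfspace_Re_gt)+
  show "{s. Re s > 1} \<noteq> {}"
    by (auto intro: exI[of _ 2])
  show "connected {s. Re s > max c d}"
    by (intro convex_connected convex_halfspace_Re_gt)
  show "{s. Re s > 1} \<subseteq> {s. Re s > max c d}" "0 \<in> {s. Re s > max c d}"
    using assms by auto
  show "F holomorphic_on {s. Re s > max c d}" "G holomorphic_on {s. Re s > max c d}"
    using assms unfolding phi1_continuation_def by (auto elim: holomorphic_on_subset)
  show "F s = G s" if "s \<in> {s. Re s > 1}" for s
    using that assms unfolding phi1_continuation_def by auto
qed

lemma phi1_eqI: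
  assumes "phi1_continuation z \<tau> c F" "c < 0"
  shows "phi1 z \<tau> = F 0"
  unfolding phi1_def
  by (rule the_equality) (use assms phi1_continuation_unique in blast)+

text \<open>The operator \<open>\<partial>/\<partial>z = (\<partial>/\<partial>x - \<i> \<partial>/\<partial>y) / 2\<close> for \<open>z = x + \<i> y\<close>.\<close>

definition wirtinger :: "(complex \<Rightarrow> complex) \<Rightarrow> complex \<Rightarrow> complex" where
  "wirtinger h z =
     (vector_derivative (\<lambda>t. h (z + of_real t)) (at 0)
      - \<i> * vector_derivative (\<lambda>t. h (z + \<i> * of_real t)) (at 0)) / 2"

definition Tay :: "complex \<Rightarrow> (complex \<Rightarrow> complex \<Rightarrow> complex) \<Rightarrow> complex \<Rightarrow> complex fps" where
  "Tay z0 h \<tau> = Abs_fps (\<lambda>n. (wirtinger ^^ n) (\<lambda>z. h z \<tau>) z0 / fact n)"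

text \<open>
  \<open>\<complex>[[X,Y]]\<close> is represented as \<open>\<complex>[[X]][[Y]]\<close>: the coefficient of \<open>X\<^sup>iY\<^sup>j\<close> in \<open>G\<close> is \<open>fps_nth (fps_nth G j) i\<close>.
\<close>

definition fps2_X :: "complex fps fps" where
  "fps2_X = fps_const fps_X"

definition fps2_Y :: "complex fps fps" where
  "fps2_Y = fps_X"

text \<open>
  Substitution of a bivariate series \<open>G\<close> with zero constant term into a univariate series \<open>f\<close>.
  As \<open>G\<^sup>n\<close> only has terms of total degree at least \<open>n\<close>, the coefficient of \<open>X\<^sup>iY\<^sup>j\<close> in
  \<open>\<Sum>n. f\<^sub>n G\<^sup>n\<close> is the finite sum below. (The library's composition of univariate series
  is not applicable, because the \<open>Y\<close>-constant coefficient of \<open>-X-Y\<close> is \<open>-X \<noteq> 0\<close>.)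
\<close>

definition fps2_subst :: "complex fps \<Rightarrow> complex fps fps \<Rightarrow> complex fps fps" where
  "fps2_subst f G = Abs_fps (\<lambda>j. Abs_fps (\<lambda>i. \<Sum>n=0..i+j. fps_nth f n * fps_nth (fps_nth (G ^ n) j) i))"

end

theory Submission
  imports Defs
begin

text \<open>
  The function \<open>\<phi>\<^sub>1\<close> is \<open>\<zeta>(z) - a z - b cnj z\<close> for constants \<open>a\<close>, \<open>b\<close>. As the arguments add up to
  \<open>0\<close>, both on the level of points and of formal variables, the linear terms cancel and the claim
  is the Taylor expansion of \<open>(\<zeta>(u) + \<zeta>(v) + \<zeta>(w))\<^sup>2 = \<wp>(u) + \<wp>(v) + \<wp>(w)\<close> for \<open>u + v + w = 0\<close>.
  The latter holds by Liouville's theorem, the difference of both sides being elliptic in \<open>u\<close> and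
  tending to \<open>0\<close> at its possible singularities.

  For the analytic continuation, expand \<open>(z + \<omega>)\<^bsup>-1\<^esup> |z + \<omega>|\<^bsup>-s\<^esup>\<close> to first order in \<open>z/\<omega>\<close>. The
  remainder converges absolutely for \<open>Re s > -1\<close>, which leaves the sums of \<open>\<omega>\<^bsup>-2\<^esup> |\<omega>|\<^bsup>-s\<^esup>\<close> and
  \<open>|\<omega>|\<^bsup>-2-s\<^esup>\<close>. Decomposing the lattice \<open>\<Lambda>\<close> into cosets of \<open>N\<Lambda>\<close> continues \<open>(N\<^bsup>s\<^esup> - 1)\<close> times such a
  sum; \<open>N = 2\<close> and \<open>N = 3\<close> together leave at most a simple pole at \<open>s = 0\<close>. This pole is compensated by a
  factor \<open>s\<close> in the second case and is absent in the first, because the residue is a multiple of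
  \<open>\<wp>(1/2) + \<wp>(\<tau>/2) + \<wp>((1+\<tau>)/2)\<close>, which vanishes by the identity above.
\<close>

section \<open>Sums over the lattice\<close>

lemma
  fixes f g :: "'a \<Rightarrow> 'b :: {topological_ab_group_add, t2_space}"
  assumes f: "f summable_on A" and g: "g summable_on A"
  shows summable_on_diff: "(\<lambda>x. f x - g x) summable_on A"
    and infsum_diff: "(\<Sum>\<^sub>\<infinity>x\<in>A. f x - g x) = infsum f A - infsum g A"
proof -
  have g': "(\<lambda>x. - g x) summable_on A" using g by (simp add: summable_on_uminus)
  show "(\<lambda>x. f x - g x) summable_on A" using summable_on_add[OF f g'] by simp
  show "(\<Sum>\<^sub>\<infinity>x\<in>A. f x - g x) = infsum f A - infsum g A"
    using infsum_add[OF f g'] by (simp add: infsum_uminus)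
qed

text \<open>Weierstrass' theorem on locally uniform convergence. The majorant \<open>M\<close> may
  fail at finitely many indices, which for lattice sums are the points too small for an asymptotic
  estimate; on a compact ball these finitely many terms are bounded anyway, and \<open>M'\<close>
  patches the majorant there.\<close>

lemma
  fixes f :: "'i \<Rightarrow> complex \<Rightarrow> complex"
  assumes holo: "\<And>i. i \<in> I \<Longrightarrow> f i holomorphic_on S" and S: "open S"
    and bound: "\<And>x. x \<in> S \<Longrightarrow> \<exists>r>0. \<exists>M. cball x r \<subseteq> S \<and> M summable_on I \<and>
                  finite {i\<in>I. \<exists>y\<in>cball x r. norm (f i y) > M i}"
  shows infsum_has_field_derivative: "\<And>x. x \<in> S \<Longrightarrow>
          ((\<lambda>x. \<Sum>\<^sub>\<infinity>i\<in>I. f i x) has_field_derivative (\<Sum>\<^sub>\<infinity>i\<in>I. deriv (f i) x)) (at x)"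
    and holomorphic_on_infsum: "(\<lambda>x. \<Sum>\<^sub>\<infinity>i\<in>I. f i x) holomorphic_on S"
    and summable_on_locally_bounded: "\<And>x. x \<in> S \<Longrightarrow> (\<lambda>i. f i x) summable_on I"
proof -
  have *: "((\<lambda>x. \<Sum>\<^sub>\<infinity>i\<in>I. f i x) has_field_derivative (\<Sum>\<^sub>\<infinity>i\<in>I. deriv (f i) x)) (at x) \<and>
           (\<lambda>i. f i x) summable_on I"
    if x: "x \<in> S" for x
  proof -
    obtain r M where r: "r > 0" "cball x r \<subseteq> S" and M: "M summable_on I"
      and fin: "finite {i\<in>I. \<exists>y\<in>cball x r. norm (f i y) > M i}"
      using bound[OF x] by blast
    define E where "E = {i\<in>I. \<exists>y\<in>cball x r. norm (f i y) > M i}"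
    have cont: "continuous_on (cball x r) (f i)" if "i \<in> I" for i
      using holo[OF that] r(2) by (meson continuous_on_subset holomorphic_on_imp_continuous_on)
    have "\<exists>B. \<forall>y\<in>cball x r. norm (f i y) \<le> B" if "i \<in> I" for i
    proof -
      have "bounded (f i ` cball x r)"
        using cont[OF that] by (intro compact_imp_bounded compact_continuous_image) auto
      thus ?thesis by (auto simp: bounded_iff)
    qed
    then obtain B where B: "\<And>i y. i \<in> I \<Longrightarrow> y \<in> cball x r \<Longrightarrow> norm (f i y) \<le> B i"
      by metis
    define M' where "M' = (\<lambda>i. if i \<in> E then B i else M i)"
    have le: "norm (f i y) \<le> M' i" if "i \<in> I" "y \<in> cball x r" for i y
      using B[OF that] that by (force simp: M'_def E_def not_less)
    have sM': "M' summable_on I"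
    proof -
      have "M' summable_on E \<union> (I - E)"
      proof (rule summable_on_Un_disjoint)
        show "M' summable_on E" using fin by (simp add: E_def)
        have "M summable_on (I - E)"
          using M by (rule summable_on_subset_banach) auto
        thus "M' summable_on I - E"
          by (rule summable_on_cong[THEN iffD1, rotated]) (auto simp: M'_def)
      qed auto
      moreover have "E \<union> (I - E) = I" by (auto simp: E_def)
      ultimately show ?thesis by simp
    qed
    have ul: "uniform_limit (cball x r) (\<lambda>X y. \<Sum>i\<in>X. f i y) (\<lambda>y. \<Sum>\<^sub>\<infinity>i\<in>I. f i y)
                (finite_subsets_at_top I)"
      by (rule Weierstrass_m_test_general[OF le sM'])
    have ev: "\<forall>\<^sub>F X in finite_subsets_at_top I.
      continuous_on (cball x r) (\<lambda>y. \<Sum>i\<in>X. f i y) \<and>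
      (\<forall>w\<in>ball x r. ((\<lambda>y. \<Sum>i\<in>X. f i y) has_field_derivative (\<Sum>i\<in>X. deriv (f i) w)) (at w))"
    proof (rule eventually_finite_subsets_at_top_weakI, intro conjI ballI)
      fix X assume X: "finite X" "X \<subseteq> I"
      show "continuous_on (cball x r) (\<lambda>y. \<Sum>i\<in>X. f i y)"
        using X by (intro continuous_on_sum cont) auto
      fix w assume "w \<in> ball x r"
      hence "w \<in> S" using r(2) by auto
      thus "((\<lambda>y. \<Sum>i\<in>X. f i y) has_field_derivative (\<Sum>i\<in>X. deriv (f i) w)) (at w)"
        using X by (intro DERIV_sum holomorphic_derivI[OF holo S]) auto
    qed
    obtain g' where g': "\<And>w. w \<in> ball x r \<Longrightarrow>
       ((\<lambda>y. \<Sum>\<^sub>\<infinity>i\<in>I. f i y) has_field_derivative (g' w)) (at w) \<and>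
       ((\<lambda>X. \<Sum>i\<in>X. deriv (f i) w) \<longlongrightarrow> g' w) (finite_subsets_at_top I)"
      using has_complex_derivative_uniform_limit[OF ev ul _ r(1)] by auto
    have "((\<lambda>i. deriv (f i) x) has_sum g' x) I"
      using g'[of x] r(1) by (simp add: has_sum_def)
    hence "g' x = (\<Sum>\<^sub>\<infinity>i\<in>I. deriv (f i) x)" by (simp add: infsumI)
    moreover have "(\<lambda>i. norm (f i x)) summable_on I"
      using Infinite_Sum.abs_summable_on_comparison_test'[OF sM', of "\<lambda>i. f i x"] le r(1) by simp
    ultimately show ?thesis
      using g'[of x] r(1) abs_summable_summable by auto
  qed
  show "\<And>x. x \<in> S \<Longrightarrow>
          ((\<lambda>x. \<Sum>\<^sub>\<infinity>i\<in>I. f i x) has_field_derivative (\<Sum>\<^sub>\<infinity>i\<in>I. deriv (f i) x)) (at x)"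
    "\<And>x. x \<in> S \<Longrightarrow> (\<lambda>i. f i x) summable_on I"
    using * by auto
  show "(\<lambda>x. \<Sum>\<^sub>\<infinity>i\<in>I. f i x) holomorphic_on S"
    using * S holomorphic_on_open by blast
qed

section \<open>Lattice terms and their first-order remainders\<close>

text \<open>The value at \<open>w = 0\<close> is \<open>0\<close>, so sums over the full lattice omit the undefined term.\<close>

definition lat_term :: "nat \<Rightarrow> complex \<Rightarrow> complex \<Rightarrow> complex" where
  "lat_term k \<sigma> w = inverse (w ^ k) * of_real (cmod w) powr (- \<sigma>)"

text \<open>The remainder of the first-order Taylor expansion of \<open>w \<mapsto> w\<^bsup>-k\<^esup> |w|\<^bsup>-\<sigma>\<^esup>\<close> at \<open>\<omega>\<close>.\<close>

definition lat_rem :: "nat \<Rightarrow> complex \<Rightarrow> complex \<Rightarrow> complex \<Rightarrow> complex" where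
  "lat_rem k \<sigma> z \<omega> = lat_term k \<sigma> (\<omega> + z)
     - lat_term k \<sigma> \<omega> * (1 - (of_nat k + \<sigma> / 2) * (z / \<omega>) - \<sigma> / 2 * cnj (z / \<omega>))"

lemma lat_term_0 [simp]: "lat_term k \<sigma> 0 = 0"
  by (simp add: lat_term_def)

lemma lat_term_mult: "lat_term k \<sigma> (a * b) = lat_term k \<sigma> a * lat_term k \<sigma> b"
  by (simp add: lat_term_def norm_mult power_mult_distrib powr_times_real)

lemma lat_term_uminus: "lat_term k \<sigma> (- w) = (-1) ^ k * lat_term k \<sigma> w"
  by (cases "even k") (auto simp: lat_term_def)

lemma norm_lat_term:
  assumes "w \<noteq> 0"
  shows "norm (lat_term k \<sigma> w) = cmod w powr (- real k - Re \<sigma>)"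
proof -
  have "norm (lat_term k \<sigma> w) = inverse (cmod w ^ k) * cmod w powr (- Re \<sigma>)"
    using assms by (simp add: lat_term_def norm_mult norm_inverse norm_power norm_powr_real_powr)
  also have "inverse (cmod w ^ k) = cmod w powr (- real k)"
    using assms by (simp add: powr_minus powr_realpow)
  also have "\<dots> * cmod w powr (- Re \<sigma>) = cmod w powr (- real k - Re \<sigma>)"
    using assms by (simp flip: powr_add)
  finally show ?thesis .
qed

lemma lat_term_exponent_0: "k > 0 \<Longrightarrow> lat_term k 0 w = inverse (w ^ k)"
  by (cases "w = 0") (auto simp: lat_term_def)

lemma holomorphic_lat_term: "(\<lambda>\<sigma>. lat_term k \<sigma> w) holomorphic_on S"
proof (cases "w = 0")
  case False
  thus ?thesis unfolding lat_term_def powr_def by (auto intro!: holomorphic_intros)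
qed auto

lemma holomorphic_lat_rem: "(\<lambda>\<sigma>. lat_rem k \<sigma> z \<omega>) holomorphic_on S"
  unfolding lat_rem_def by (intro holomorphic_intros holomorphic_lat_term) auto

lemma lat_rem_0_left [simp]: "lat_rem k \<sigma> 0 \<omega> = 0"
  by (simp add: lat_rem_def)

text \<open>As |exp L| = exp (Re L), the term is a single exponential in logarithmic coordinates;
  expanding it then only needs the expansions of \<open>exp\<close> and \<open>Ln\<close>.\<close>

lemma lat_term_exp:
  "lat_term k \<sigma> (exp L) = exp (- (of_nat k * L + \<sigma> * of_real (Re L)))"
proof -
  have "complex_of_real (cmod (exp L)) powr (- \<sigma>) = exp (- \<sigma> * of_real (Re L))"
    by (simp add: powr_def Ln_of_real)
  moreover have "inverse (exp L ^ k) = exp (- (of_nat k * L))"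
    by (simp add: exp_of_nat_mult exp_minus)
  ultimately show ?thesis
    by (simp add: lat_term_def mult_exp_exp)
qed

text \<open>With u = z/\<omega> and L = Ln (1 + u), the term at \<omega> + z is the term at \<omega>
  times exp E, where E = -(k L + \<sigma> Re L) is O(u). Both exp E - 1 - E and the deviation of E
  from its linear part are O(|u|^2). The constant depends on \<sigma> only through \<open>B\<close>,
  which makes the bound locally uniform in \<sigma>.\<close>

lemma norm_lat_rem_le:
  assumes \<omega>: "\<omega> \<noteq> 0" and z: "norm z \<le> norm \<omega> / 4" and \<sigma>: "norm \<sigma> \<le> B"
  shows "norm (lat_rem k \<sigma> z \<omega>) \<le>
           (exp ((real k + B) / 2) * 4 * (real k + B)\<^sup>2 + 2 * (real k + B)) * norm z ^ 2
           * cmod \<omega> powr (- real k - Re \<sigma> - 2)"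
proof -
  define u L where "u = z / \<omega>" and "L = Ln (1 + u)"
  define D where "D = real k + B"
  have B0: "B \<ge> 0" using \<sigma> norm_ge_zero order_trans by blast
  have D0: "D \<ge> 0" using B0 by (simp add: D_def)
  have u: "norm u \<le> 1/4" using z \<omega> by (simp add: u_def norm_divide field_simps)
  have nz: "1 + u \<noteq> 0"
  proof
    assume "1 + u = 0"
    hence "u = -1" by (simp add: eq_neg_iff_add_eq_0 add.commute)
    thus False using u by simp
  qed
  have expL: "exp L = 1 + u" using nz by (simp add: L_def)
  have L1: "norm L \<le> 2 * norm u" unfolding L_def using u by (intro norm_Ln_le) auto
  have "norm (L - u) \<le> norm u ^ 2 / (1 - norm u)" unfolding L_def using u
    by (intro Ln_approx_linear) auto
  also have "\<dots> \<le> norm u ^ 2 / (1/2)" using u by (intro divide_left_mono) auto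
  finally have L2: "norm (L - u) \<le> 2 * norm u ^ 2" by simp
  define E where "E = - (of_nat k * L + \<sigma> * of_real (Re L))"
  have nE: "norm E \<le> D * norm L"
  proof -
    have "norm E \<le> norm (of_nat k * L) + norm (\<sigma> * of_real (Re L))"
      unfolding E_def norm_minus_cancel by (rule norm_triangle_ineq)
    also have "\<dots> \<le> real k * norm L + B * norm L"
      unfolding norm_mult using \<sigma> B0 abs_Re_le_cmod[of L]
      by (intro add_mono mult_mono) auto
    finally show ?thesis by (simp add: D_def algebra_simps)
  qed
  also have "\<dots> \<le> D * (2 * norm u)" using L1 D0 by (intro mult_left_mono)
  finally have nE': "norm E \<le> 2 * D * norm u" by simp
  also have "\<dots> \<le> 2 * D * (1/4)" using u D0 by (intro mult_left_mono) auto
  finally have nE'': "norm E \<le> D / 2" by simp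
  have "norm (exp E - 1 - E) \<le> exp \<bar>Re E\<bar> * norm E ^ 2"
    using Taylor_exp[of E 1] by (simp add: algebra_simps power2_eq_square)
  also have "\<dots> \<le> exp (D / 2) * (2 * D * norm u) ^ 2"
    using nE' nE'' abs_Re_le_cmod[of E] by (intro mult_mono power_mono) auto
  finally have 1: "norm (exp E - 1 - E) \<le> exp (D/2) * 4 * D\<^sup>2 * norm u ^ 2"
    by (simp add: power_mult_distrib)
  \<comment> \<open>\<open>F\<close> is E minus its linearisation in u. The latter contains
    \<open>cnj u\<close> because the factor |w|^(-\<sigma>) contributes Re u = (u + cnj u) /
    2.\<close>
  define F where "F = E + (of_nat k + \<sigma> / 2) * u + \<sigma> / 2 * cnj u"
  have "u + cnj u = 2 * of_real (Re u)"
    by (simp add: complex_add_cnj)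
  hence "\<sigma> / 2 * u + \<sigma> / 2 * cnj u = \<sigma> * of_real (Re u)"
    by (simp add: field_simps flip: distrib_left)
  hence F: "F = - (of_nat k * (L - u) + \<sigma> * of_real (Re (L - u)))"
    unfolding F_def E_def by (simp add: algebra_simps)
  have "norm F \<le> norm (of_nat k * (L - u)) + norm (\<sigma> * of_real (Re (L - u)))"
    unfolding F norm_minus_cancel by (rule norm_triangle_ineq)
  also have "\<dots> \<le> real k * norm (L - u) + B * norm (L - u)"
    unfolding norm_mult using \<sigma> B0 abs_Re_le_cmod[of "L - u"]
    by (intro add_mono mult_mono) (auto simp del: minus_complex.sel)
  also have "\<dots> = D * norm (L - u)" by (simp add: D_def algebra_simps)
  also have "\<dots> \<le> D * (2 * norm u ^ 2)" using L2 D0 by (intro mult_left_mono)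
  finally have 2: "norm F \<le> 2 * D * norm u ^ 2" by simp
  have "\<omega> + z = \<omega> * (1 + u)" using \<omega> by (simp add: u_def field_simps)
  hence "lat_term k \<sigma> (\<omega> + z) = lat_term k \<sigma> \<omega> * exp E"
    by (simp add: lat_term_mult flip: expL) (simp add: lat_term_exp E_def)
  hence "lat_rem k \<sigma> z \<omega> = lat_term k \<sigma> \<omega> * ((exp E - 1 - E) + F)"
    unfolding lat_rem_def u_def[symmetric] F_def by (simp add: algebra_simps)
  hence "norm (lat_rem k \<sigma> z \<omega>) = norm (lat_term k \<sigma> \<omega>) * norm ((exp E - 1 - E) + F)"
    by (simp add: norm_mult)
  also have "\<dots> \<le> norm (lat_term k \<sigma> \<omega>) * (exp (D/2) * 4 * D\<^sup>2 * norm u ^ 2 + 2 * D * norm u ^ 2)"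
    using 1 2 by (intro mult_left_mono norm_triangle_mono) auto
  also have "\<dots> = (exp (D/2) * 4 * D\<^sup>2 + 2 * D) * norm z ^ 2 * (norm (lat_term k \<sigma> \<omega>) / norm \<omega> ^ 2)"
    by (simp add: u_def norm_divide power_divide algebra_simps add_divide_distrib)
  also have "norm (lat_term k \<sigma> \<omega>) / norm \<omega> ^ 2 = cmod \<omega> powr (- real k - Re \<sigma> - 2)"
    using \<omega> by (simp add: norm_lat_term powr_diff powr_numeral)
  finally show ?thesis by (simp add: D_def)
qed

lemma summable_on_int_powr:
  fixes q :: real
  assumes "q > 1"
  shows "(\<lambda>m::int. (1 + real_of_int \<bar>m\<bar>) powr - q) summable_on UNIV"
proof -
  let ?f = "\<lambda>m::int. (1 + real_of_int \<bar>m\<bar>) powr - q"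
  have "summable (\<lambda>n. real (Suc n) powr - q)"
    using assms summable_real_powr_iff[of "-q"] by (subst summable_Suc_iff) simp
  hence N: "(\<lambda>n. (1 + real n) powr - q) summable_on UNIV"
    by (subst summable_on_UNIV_nonneg_real_iff) auto
  have 1: "?f summable_on range int"
    by (subst summable_on_reindex) (use N in \<open>auto simp: o_def inj_on_def\<close>)
  have 2: "?f summable_on range (\<lambda>n. - int n)"
    by (subst summable_on_reindex) (use N in \<open>auto simp: o_def inj_on_def\<close>)
  have 2: "?f summable_on (range (\<lambda>n. - int n) - range int)"
    using 2 by (rule summable_on_subset_banach) auto
  have "?f summable_on (range int \<union> (range (\<lambda>n. - int n) - range int))"
    by (intro summable_on_Un_disjoint 1 2) auto
  moreover have "range int \<union> (range (\<lambda>n. - int n) - range int) = UNIV"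
  proof -
    have "x \<in> range int \<or> x \<in> range (\<lambda>n. - int n)" for x :: int
      by (cases x rule: int_cases2) auto
    thus ?thesis by blast
  qed
  ultimately show ?thesis by simp
qed

text \<open>The first equation forces s to be imaginary. A nonzero common solution would make ln 3 /
  ln 2 rational, hence a positive power of 3 equal to a power of 2, against parity. So the factors
  N^s - 1 for N = 2 and N = 3 vanish together only at s = 0.\<close>

lemma two_three_powr_common_period:
  fixes s :: complex
  assumes 2: "2 powr s = 1" and 3: "3 powr s = 1"
  shows "s = 0"
proof -
  have "exp (s * of_real (ln 2)) = 1" "exp (s * of_real (ln 3)) = 1"
    using 2 3 Ln_of_real[of 2] Ln_of_real[of 3] by (simp_all add: powr_def)
  then obtain a b :: int where a: "Re s * ln 2 = 0" "Im s * ln 2 = of_int (2 * a) * pi"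
    and b: "Im s * ln 3 = of_int (2 * b) * pi"
    unfolding exp_eq_1 by auto
  show ?thesis
  proof (cases "a = 0")
    case True
    thus ?thesis using a by (simp add: complex_eq_iff)
  next
    case False
    have "Im s \<noteq> 0" using a(2) False by auto
    have "Im s * (ln 3 * of_int a) = Im s * (ln 2 * of_int b)"
    proof -
      have "Im s * ln 3 * of_int a = of_int (2 * b) * pi * of_int a" by (simp only: b)
      also have "\<dots> = of_int (2 * a) * pi * of_int b" by simp
      also have "\<dots> = Im s * ln 2 * of_int b" by (simp only: a)
      finally show ?thesis by (simp add: mult_ac)
    qed
    hence eq: "ln 3 * real_of_int a = ln 2 * real_of_int b" using \<open>Im s \<noteq> 0\<close> by simp
    hence "\<bar>ln 3 * real_of_int a\<bar> = \<bar>ln 2 * real_of_int b\<bar>" by simp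
    hence "ln 3 * real (nat \<bar>a\<bar>) = ln 2 * real (nat \<bar>b\<bar>)" by (simp add: abs_mult)
    hence "ln ((3::real) ^ nat \<bar>a\<bar>) = ln (2 ^ nat \<bar>b\<bar>)" by (simp add: ln_realpow mult.commute)
    hence "(3::real) ^ nat \<bar>a\<bar> = 2 ^ nat \<bar>b\<bar>" by simp
    hence eq3: "(3::nat) ^ nat \<bar>a\<bar> = 2 ^ nat \<bar>b\<bar>"
      by (metis of_nat_eq_iff of_nat_numeral of_nat_power)
    have "odd ((3::nat) ^ nat \<bar>a\<bar>)" by simp
    hence "nat \<bar>b\<bar> = 0" unfolding eq3 by simp
    hence "(3::nat) ^ nat \<bar>a\<bar> = 1" using eq3 by simp
    thus ?thesis using False by simp
  qed
qed

section \<open>The period lattice: discreteness and absolute convergence\<close>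

locale period_half_plane =
  fixes \<tau> :: complex
  assumes Im_pos: "Im \<tau> > 0"
begin

abbreviation \<Lambda> :: "complex set" where "\<Lambda> \<equiv> period_lattice \<tau>"

lemma zero_in_lattice [simp, intro]: "0 \<in> \<Lambda>"
  unfolding period_lattice_def by (auto intro!: exI[of _ 0])

lemma one_in_lattice [simp, intro]: "1 \<in> \<Lambda>"
  unfolding period_lattice_def by (intro CollectI exI[of _ 0] exI[of _ 1]) auto

lemma tau_in_lattice [simp, intro]: "\<tau> \<in> \<Lambda>"
  unfolding period_lattice_def by (intro CollectI exI[of _ 0] exI[of _ 1]) auto

lemma lattice_add [intro]:
  assumes "x \<in> \<Lambda>" "y \<in> \<Lambda>"
  shows "x + y \<in> \<Lambda>"
proof -
  obtain m n m' n' :: int where "x = of_int m * \<tau> + of_int n" "y = of_int m' * \<tau> + of_int n'"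
    using assms unfolding period_lattice_def by blast
  hence "x + y = of_int (m + m') * \<tau> + of_int (n + n')" by (simp add: algebra_simps)
  thus ?thesis unfolding period_lattice_def by blast
qed

lemma lattice_uminus_iff [simp]: "- x \<in> \<Lambda> \<longleftrightarrow> x \<in> \<Lambda>"
proof -
  have "- y \<in> \<Lambda>" if y: "y \<in> \<Lambda>" for y
  proof -
    obtain m n :: int where "y = of_int m * \<tau> + of_int n"
      using y unfolding period_lattice_def by blast
    hence "- y = of_int (- m) * \<tau> + of_int (- n)" by simp
    thus ?thesis unfolding period_lattice_def by blast
  qed
  from this[of x] this[of "- x"] show ?thesis by auto
qed

lemma lattice_diff [intro]: "x \<in> \<Lambda> \<Longrightarrow> y \<in> \<Lambda> \<Longrightarrow> x - y \<in> \<Lambda>"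
  using lattice_add[of x "- y"] by simp

lemma lattice_add_cancel [simp]:
  assumes "y \<in> \<Lambda>"
  shows "x + y \<in> \<Lambda> \<longleftrightarrow> x \<in> \<Lambda>" "y + x \<in> \<Lambda> \<longleftrightarrow> x \<in> \<Lambda>"
  using lattice_add[of x y] lattice_diff[of "x + y" y] assms by (auto simp: add.commute)

lemma lattice_bij: "bij_betw (\<lambda>(m, n). of_int m * \<tau> + of_int n) (UNIV :: (int \<times> int) set) \<Lambda>"
proof (rule bij_betw_imageI)
  show "inj (\<lambda>(m::int, n::int). of_int m * \<tau> + of_int n)"
  proof (rule injI, clarify)
    fix m n m' n' :: int
    assume eq: "of_int m * \<tau> + of_int n = of_int m' * \<tau> + of_int n'"
    have "real_of_int m * Im \<tau> = of_int m' * Im \<tau>" using arg_cong[OF eq, of Im] by simp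
    hence "m = m'" using Im_pos by simp
    thus "m = m' \<and> n = n'" using eq by simp
  qed
qed (auto simp: period_lattice_def)

text \<open>The imaginary part of w = m \<tau> + n is m Im \<tau>, which controls m; then n = w - m
  \<tau> is controlled as well.\<close>

lemma lattice_coeff_le:
  obtains C where "C > 0"
    "\<And>m n :: int. real_of_int \<bar>m\<bar> \<le> C * cmod (of_int m * \<tau> + of_int n)"
    "\<And>m n :: int. real_of_int \<bar>n\<bar> \<le> C * cmod (of_int m * \<tau> + of_int n)"
proof
  define C where "C = 1 / Im \<tau> + 1 + cmod \<tau> / Im \<tau>"
  show "C > 0" using Im_pos by (auto simp: C_def intro!: add_pos_nonneg)
  fix m n :: int
  let ?w = "of_int m * \<tau> + of_int n :: complex"
  have "\<bar>Im ?w\<bar> \<le> cmod ?w" by (rule abs_Im_le_cmod)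
  hence m: "\<bar>real_of_int m\<bar> * Im \<tau> \<le> cmod ?w" using Im_pos by (simp add: abs_mult)
  hence m': "\<bar>real_of_int m\<bar> \<le> cmod ?w / Im \<tau>" using Im_pos by (simp add: field_simps)
  also have "\<dots> \<le> C * cmod ?w" using Im_pos by (simp add: C_def algebra_simps)
  finally show "real_of_int \<bar>m\<bar> \<le> C * cmod ?w" by simp
  have "\<bar>real_of_int n\<bar> = cmod (?w - of_int m * \<tau>)" by simp
  also have "\<dots> \<le> cmod ?w + \<bar>real_of_int m\<bar> * cmod \<tau>"
    by (rule order.trans[OF norm_triangle_ineq4]) (simp add: norm_mult)
  also have "\<dots> \<le> cmod ?w + cmod ?w / Im \<tau> * cmod \<tau>"
    using m' by (intro add_left_mono mult_right_mono) auto
  also have "\<dots> \<le> C * cmod ?w" using Im_pos by (simp add: C_def algebra_simps)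
  finally show "real_of_int \<bar>n\<bar> \<le> C * cmod ?w" by simp
qed

lemma finite_lattice_cball: "finite {\<omega>\<in>\<Lambda>. cmod \<omega> \<le> R}"
proof -
  obtain C where C: "C > 0"
    "\<And>m n :: int. real_of_int \<bar>m\<bar> \<le> C * cmod (of_int m * \<tau> + of_int n)"
    "\<And>m n :: int. real_of_int \<bar>n\<bar> \<le> C * cmod (of_int m * \<tau> + of_int n)"
    using lattice_coeff_le by blast
  define N where "N = \<lceil>C * R\<rceil>"
  have "{\<omega>\<in>\<Lambda>. cmod \<omega> \<le> R} \<subseteq> (\<lambda>(m, n). of_int m * \<tau> + of_int n) ` ({-N..N} \<times> {-N..N})"
  proof clarify
    fix \<omega> assume "\<omega> \<in> \<Lambda>" and le: "cmod \<omega> \<le> R"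
    then obtain m n :: int where \<omega>: "\<omega> = of_int m * \<tau> + of_int n"
      unfolding period_lattice_def by auto
    have "C * cmod \<omega> \<le> C * R" using le C(1) by simp
    hence "real_of_int \<bar>m\<bar> \<le> C * R" "real_of_int \<bar>n\<bar> \<le> C * R"
      using C(2)[of m n] C(3)[of n m] unfolding \<omega> by linarith+
    hence "\<bar>m\<bar> \<le> N" "\<bar>n\<bar> \<le> N" unfolding N_def by linarith+
    thus "\<omega> \<in> (\<lambda>(m, n). of_int m * \<tau> + of_int n) ` ({-N..N} \<times> {-N..N})"
      using \<omega> by (intro image_eqI[of _ _ "(m, n)"]) auto
  qed
  thus ?thesis by (rule finite_subset) auto
qed

lemma countable_lattice: "countable \<Lambda>"
  by (subst bij_betw_imp_surj_on[OF lattice_bij, symmetric]) auto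

text \<open>Local finiteness of the lattice passes to all its subsets. Subsets such as the lattice
  without one point occur when a single singularity is examined.\<close>

lemma open_lattice_compl:
  assumes A: "A \<subseteq> \<Lambda>"
  shows "open (- A)"
proof (rule openI)
  fix x assume x: "x \<in> - A"
  let ?F = "{\<omega>\<in>A. cmod \<omega> \<le> cmod x + 1}"
  have "finite ?F" using A by (intro finite_subset[OF _ finite_lattice_cball[of "cmod x + 1"]]) auto
  hence "open (ball x 1 - ?F)" by (intro open_Diff finite_imp_closed) auto
  moreover have "x \<in> ball x 1 - ?F" using x by auto
  ultimately obtain e where e: "e > 0" "ball x e \<subseteq> ball x 1 - ?F"
    using open_contains_ball by blast
  have "ball x e \<subseteq> - A"
  proof
    fix y assume y: "y \<in> ball x e"
    hence "dist x y < 1" using e by auto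
    hence "cmod y \<le> cmod x + 1"
      using norm_triangle_sub[of y x] by (simp add: dist_norm norm_minus_commute)
    thus "y \<in> - A" using y e by auto
  qed
  thus "\<exists>e>0. ball x e \<subseteq> - A" using e by blast
qed

text \<open>For w = m \<tau> + n \<noteq> 0 both 1 + |m| and 1 + |n| are at most 2 C |w|. Hence
  |w|^(-p) is at most a constant times ((1 + |m|) (1 + |n|))^(-p/2), a product of two
  one-dimensional summable families because p/2 > 1.\<close>

lemma lattice_summable:
  assumes p: "p > 2"
  shows "(\<lambda>\<omega>. cmod \<omega> powr - p) summable_on \<Lambda>"
proof -
  obtain C where C: "C > 0"
    "\<And>m n :: int. real_of_int \<bar>m\<bar> \<le> C * cmod (of_int m * \<tau> + of_int n)"
    "\<And>m n :: int. real_of_int \<bar>n\<bar> \<le> C * cmod (of_int m * \<tau> + of_int n)"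
    using lattice_coeff_le by blast
  define a where "a = (\<lambda>m::int. (1 + real_of_int \<bar>m\<bar>) powr - (p/2))"
  have a: "a summable_on UNIV" unfolding a_def using p by (intro summable_on_int_powr) auto
  have a0: "a m \<ge> 0" for m by (simp add: a_def)
  have "(\<lambda>(m, n). a m * a n) summable_on UNIV \<times> UNIV"
  proof (rule summable_on_SigmaI)
    show "((\<lambda>n. case (m, n) of (m, n) \<Rightarrow> a m * a n) has_sum (a m * infsum a UNIV)) UNIV" for m
      using a by (auto intro!: has_sum_cmult_right)
    show "(\<lambda>m. a m * infsum a UNIV) summable_on UNIV"
      by (intro summable_on_cmult_left a)
  qed (auto simp: a0)
  hence "(\<lambda>x. (2 * C) powr p * (case x of (m, n) \<Rightarrow> a m * a n)) summable_on UNIV"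
    by (intro summable_on_cmult_right) simp
  hence "(\<lambda>x. cmod ((\<lambda>(m, n). of_int m * \<tau> + of_int n) x) powr - p) summable_on UNIV"
  proof (rule summable_on_comparison_test)
    fix x :: "int \<times> int"
    obtain m n where x: "x = (m, n)" by force
    let ?w = "of_int m * \<tau> + of_int n :: complex"
    show "cmod ((\<lambda>(m, n). of_int m * \<tau> + of_int n) x) powr - p
            \<le> (2 * C) powr p * (case x of (m, n) \<Rightarrow> a m * a n)"
    proof (cases "m = 0 \<and> n = 0")
      case True
      thus ?thesis by (simp add: x a0)
    next
      case False
      hence "real_of_int \<bar>m\<bar> \<ge> 1 \<or> real_of_int \<bar>n\<bar> \<ge> 1" by linarith
      hence 1: "1 \<le> C * cmod ?w" using C(2)[of m n] C(3)[of n m] by linarith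
      have w0: "?w \<noteq> 0" using 1 by auto
      have "a m * a n = ((1 + real_of_int \<bar>m\<bar>) * (1 + real_of_int \<bar>n\<bar>)) powr - (p/2)"
        unfolding a_def by (simp add: powr_mult)
      also have "\<dots> \<ge> ((2 * C * cmod ?w) * (2 * C * cmod ?w)) powr - (p/2)"
        using 1 C(2)[of m n] C(3)[of n m] p by (intro powr_mono2' mult_mono mult_pos_pos) auto
      also have "((2 * C * cmod ?w) * (2 * C * cmod ?w)) powr - (p/2) = (2 * C * cmod ?w) powr - p"
        using powr_mult[of "2 * C * cmod ?w" "2 * C * cmod ?w" "- (p/2)"] C(1)
        by (simp only: flip: powr_add) auto
      also have "\<dots> = (2 * C) powr - p * cmod ?w powr - p"
        using C(1) by (simp add: powr_mult)
      finally have "(2 * C) powr p * ((2 * C) powr - p * cmod ?w powr - p) \<le> (2 * C) powr p * (a m * a n)"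
        using C(1) by (intro mult_left_mono) auto
      also have "(2 * C) powr p * ((2 * C) powr - p * cmod ?w powr - p) = cmod ?w powr - p"
        using C(1) by (simp add: powr_minus)
      finally show ?thesis by (simp add: x)
    qed
  qed auto
  thus ?thesis
    using summable_on_reindex_bij_betw[OF lattice_bij, of "\<lambda>\<omega>. cmod \<omega> powr - p"] by simp
qed

lemma lat_term_summable:
  assumes "real k + Re \<sigma> > 2"
  shows "(\<lambda>\<omega>. lat_term k \<sigma> \<omega>) summable_on \<Lambda>"
proof (rule abs_summable_summable, rule Infinite_Sum.abs_summable_on_comparison_test')
  show "(\<lambda>\<omega>. cmod \<omega> powr - (real k + Re \<sigma>)) summable_on \<Lambda>"
    using assms by (rule lattice_summable)
  show "norm (lat_term k \<sigma> \<omega>) \<le> cmod \<omega> powr - (real k + Re \<sigma>)" for \<omega>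
    by (cases "\<omega> = 0") (simp_all add: norm_lat_term)
qed

lemma lattice_infsum_uminus: "(\<Sum>\<^sub>\<infinity>\<omega>\<in>\<Lambda>. f (- \<omega>)) = (\<Sum>\<^sub>\<infinity>\<omega>\<in>\<Lambda>. f \<omega>)"
  by (rule infsum_reindex_bij_witness[of _ uminus uminus]) auto

lemma lattice_infsum_shift: "\<omega>0 \<in> \<Lambda> \<Longrightarrow> (\<Sum>\<^sub>\<infinity>\<omega>\<in>\<Lambda>. f (\<omega> + \<omega>0)) = (\<Sum>\<^sub>\<infinity>\<omega>\<in>\<Lambda>. f \<omega>)"
  by (rule infsum_reindex_bij_witness[of _ "\<lambda>\<omega>. \<omega> - \<omega>0" "\<lambda>\<omega>. \<omega> + \<omega>0"]) auto

lemma lattice_infsum_odd: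
  fixes f :: "complex \<Rightarrow> complex"
  assumes "\<And>\<omega>. f (- \<omega>) = - f \<omega>"
  shows "(\<Sum>\<^sub>\<infinity>\<omega>\<in>\<Lambda>. f \<omega>) = 0"
proof -
  have "(\<Sum>\<^sub>\<infinity>\<omega>\<in>\<Lambda>. f \<omega>) = (\<Sum>\<^sub>\<infinity>\<omega>\<in>\<Lambda>. f (- \<omega>))"
    by (simp add: lattice_infsum_uminus)
  also have "\<dots> = - (\<Sum>\<^sub>\<infinity>\<omega>\<in>\<Lambda>. f \<omega>)"
    by (simp add: assms infsum_uminus)
  finally show ?thesis by simp
qed

definition lat_rem_sum :: "nat \<Rightarrow> complex \<Rightarrow> complex \<Rightarrow> complex" where
  "lat_rem_sum k \<sigma> z = (\<Sum>\<^sub>\<infinity>\<omega>\<in>\<Lambda>. lat_rem k \<sigma> z \<omega>)"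

text \<open>By \<open>norm_lat_rem_le\<close> the terms are O(|\<omega>|^(-k - Re \<sigma> - 2))
  locally uniformly in \<sigma>, and k + Re \<sigma> + 2 > 2 on the given half-plane. This is two
  units further to the left than the half-plane of \<open>lat_term_summable\<close>.\<close>

lemma
  shows holomorphic_lat_rem_sum: "(\<lambda>\<sigma>. lat_rem_sum k \<sigma> z) holomorphic_on {\<sigma>. Re \<sigma> > - real k}"
    and lat_rem_summable: "Re \<sigma> > - real k \<Longrightarrow> (\<lambda>\<omega>. lat_rem k \<sigma> z \<omega>) summable_on \<Lambda>"
proof -
  let ?S = "{\<sigma>. Re \<sigma> > - real k}"
  have S: "open ?S" by (rule open_halfspace_Re_gt)
  have holo: "(\<lambda>\<sigma>. lat_rem k \<sigma> z \<omega>) holomorphic_on ?S" for \<omega>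
    by (rule holomorphic_lat_rem)
  have bound: "\<exists>r>0. \<exists>M. cball \<sigma>0 r \<subseteq> ?S \<and> M summable_on \<Lambda> \<and>
      finite {\<omega>\<in>\<Lambda>. \<exists>\<sigma>\<in>cball \<sigma>0 r. M \<omega> < cmod (lat_rem k \<sigma> z \<omega>)}" if \<sigma>0: "\<sigma>0 \<in> ?S" for \<sigma>0
  proof -
    \<comment> \<open>Half the distance to the boundary line, so that Re \<sigma> + k \<ge> r on the
      whole disc.\<close>
    define r where "r = (Re \<sigma>0 + real k) / 2"
    define B where "B = cmod \<sigma>0 + r"
    define C where "C = (exp ((real k + B) / 2) * 4 * (real k + B)\<^sup>2 + 2 * (real k + B)) * norm z ^ 2"
    define M where "M = (\<lambda>\<omega>. C * cmod \<omega> powr - (r + 2))"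
    have r: "r > 0" using \<sigma>0 by (simp add: r_def)
    have Re_ge: "Re \<sigma> \<ge> r - real k" if "\<sigma> \<in> cball \<sigma>0 r" for \<sigma>
    proof -
      have "\<bar>Re (\<sigma>0 - \<sigma>)\<bar> \<le> r" using that abs_Re_le_cmod[of "\<sigma>0 - \<sigma>"] by (simp add: dist_norm)
      hence "Re \<sigma>0 - Re \<sigma> \<le> r" by simp
      thus ?thesis by (simp add: r_def field_simps)
    qed
    have "cball \<sigma>0 r \<subseteq> ?S"
    proof
      fix \<sigma> assume "\<sigma> \<in> cball \<sigma>0 r"
      from Re_ge[OF this] r show "\<sigma> \<in> ?S" by simp
    qed
    moreover have "M summable_on \<Lambda>"
      unfolding M_def using r by (intro summable_on_cmult_right lattice_summable) auto
    moreover have "finite {\<omega>\<in>\<Lambda>. \<exists>\<sigma>\<in>cball \<sigma>0 r. M \<omega> < cmod (lat_rem k \<sigma> z \<omega>)}"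
    \<comment> \<open>Beyond 4|z| the remainder estimate applies; beyond 1 the power of |\<omega>|
      is monotone in its exponent.\<close>
    proof (rule finite_subset[OF _ finite_lattice_cball[of "max 1 (4 * cmod z)"]], safe)
      fix \<omega> \<sigma> assume \<omega>: "\<omega> \<in> \<Lambda>" and \<sigma>: "\<sigma> \<in> cball \<sigma>0 r"
        and less: "M \<omega> < cmod (lat_rem k \<sigma> z \<omega>)"
      show "cmod \<omega> \<le> max 1 (4 * cmod z)"
      proof (rule ccontr)
        assume "\<not> ?thesis"
        hence \<omega>1: "cmod \<omega> \<ge> 1" "cmod z \<le> cmod \<omega> / 4" by auto
        have "cmod \<sigma> \<le> B" unfolding B_def
          using \<sigma> norm_triangle_sub[of \<sigma> \<sigma>0] by (simp add: dist_norm norm_minus_commute)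
        hence "cmod (lat_rem k \<sigma> z \<omega>) \<le> C * cmod \<omega> powr (- real k - Re \<sigma> - 2)"
          unfolding C_def using \<omega>1 by (intro norm_lat_rem_le) auto
        also have "\<dots> \<le> M \<omega>" unfolding M_def
        proof (rule mult_left_mono)
          show "cmod \<omega> powr (- real k - Re \<sigma> - 2) \<le> cmod \<omega> powr - (r + 2)"
            using \<omega>1 Re_ge[OF \<sigma>] by (intro powr_mono) auto
          show "C \<ge> 0" unfolding C_def B_def using r by auto
        qed
        finally show False using less by simp
      qed
    qed
    ultimately show ?thesis using r by blast
  qed
  show "(\<lambda>\<sigma>. lat_rem_sum k \<sigma> z) holomorphic_on ?S"
    unfolding lat_rem_sum_def by (rule holomorphic_on_infsum[OF holo S bound])
  show "(\<lambda>\<omega>. lat_rem k \<sigma> z \<omega>) summable_on \<Lambda>" if "Re \<sigma> > - real k"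
    by (rule summable_on_locally_bounded[OF holo S bound]) (use that in auto)
qed

section \<open>The Weierstrass zeta function\<close>

text \<open>This is the usual zeta function: the summand is 1/(\<omega> + z) - 1/\<omega> +
  z/\<omega>^2, and for \<omega> = 0 the convention \<open>inverse 0 = 0\<close> leaves 1/z.\<close>

definition wzeta :: "complex \<Rightarrow> complex" where
  "wzeta z = lat_rem_sum 1 0 z"

abbreviation wp :: "complex \<Rightarrow> complex" where
  "wp z \<equiv> weierstrass_p z \<tau>"

lemma lat_rem_1: "lat_rem 1 0 z \<omega> = inverse (\<omega> + z) - inverse \<omega> + z * inverse (\<omega>\<^sup>2)"
  by (cases "\<omega> = 0") (simp_all add: lat_rem_def lat_term_exponent_0 field_simps power2_eq_square)

lemma lat_rem_2:
  "lat_rem 2 0 z \<omega> = inverse ((\<omega> + z)\<^sup>2) - inverse (\<omega>\<^sup>2) + 2 * z * lat_term 3 0 \<omega>"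
  by (cases "\<omega> = 0")
    (simp_all add: lat_rem_def lat_term_exponent_0 field_simps power2_eq_square power3_eq_cube)

text \<open>For k = 2, \<sigma> = 0 the remainder differs from the usual summand of \<wp> by
  2z/\<omega>^3, which is odd in \<omega> and sums to 0. The separate term 1/z^2 becomes the summand
  for \<omega> = 0 under \<open>inverse 0 = 0\<close>.\<close>

lemma
  shows wp_summable: "(\<lambda>\<omega>. inverse ((\<omega> + z)\<^sup>2) - inverse (\<omega>\<^sup>2)) summable_on \<Lambda>"
    and wp_eq_lat_rem_sum: "wp z = lat_rem_sum 2 0 z"
    and wp_eq: "wp z = (\<Sum>\<^sub>\<infinity>\<omega>\<in>\<Lambda>. inverse ((\<omega> + z)\<^sup>2) - inverse (\<omega>\<^sup>2))"
proof -
  let ?g = "\<lambda>\<omega>. inverse ((\<omega> + z)\<^sup>2) - inverse (\<omega>\<^sup>2)"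
  let ?h = "\<lambda>\<omega>. inverse ((\<omega> - z)\<^sup>2) - inverse (\<omega>\<^sup>2)"
  have s2: "(\<lambda>\<omega>. lat_rem 2 0 x \<omega>) summable_on \<Lambda>" for x
    by (rule lat_rem_summable) simp
  have s3: "(\<lambda>\<omega>. lat_term 3 0 \<omega>) summable_on \<Lambda>" by (rule lat_term_summable) simp
  have "(\<lambda>\<omega>. lat_rem 2 0 x \<omega> - 2 * x * lat_term 3 0 \<omega>) summable_on \<Lambda>" for x
    by (intro summable_on_diff s2 summable_on_cmult_right s3)
  hence s: "(\<lambda>\<omega>. inverse ((\<omega> + x)\<^sup>2) - inverse (\<omega>\<^sup>2)) summable_on \<Lambda>" for x by (simp add: lat_rem_2)
  show "?g summable_on \<Lambda>" by (rule s)
  have "lat_rem_sum 2 0 z = (\<Sum>\<^sub>\<infinity>\<omega>\<in>\<Lambda>. ?g \<omega>) + (\<Sum>\<^sub>\<infinity>\<omega>\<in>\<Lambda>. 2 * z * lat_term 3 0 \<omega>)"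
    unfolding lat_rem_sum_def lat_rem_2 by (intro infsum_add s summable_on_cmult_right s3)
  also have "(\<Sum>\<^sub>\<infinity>\<omega>\<in>\<Lambda>. 2 * z * lat_term 3 0 \<omega>) = 0"
    by (rule lattice_infsum_odd) (simp add: lat_term_uminus)
  finally have 1: "lat_rem_sum 2 0 z = (\<Sum>\<^sub>\<infinity>\<omega>\<in>\<Lambda>. ?g \<omega>)" by simp
  have hs: "?h summable_on \<Lambda> - {0}"
    using s[of "- z"] summable_on_subset_banach[of ?h \<Lambda> "\<Lambda> - {0}"] by simp
  have "wp z = 1 / z\<^sup>2 + (\<Sum>\<^sub>\<infinity>\<omega>\<in>\<Lambda> - {0}. ?h \<omega>)"
    unfolding weierstrass_p_def
    by (intro arg_cong2[of _ _ _ _ "(+)"] infsum_cong) (auto simp: field_simps power2_commute)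
  also have "\<dots> = (\<Sum>\<^sub>\<infinity>\<omega>\<in>insert 0 (\<Lambda> - {0}). ?h \<omega>)"
    using hs by (subst infsum_insert) (auto simp: field_simps)
  also have "insert 0 (\<Lambda> - {0}) = \<Lambda>" by auto
  also have "(\<Sum>\<^sub>\<infinity>\<omega>\<in>\<Lambda>. ?h \<omega>) = (\<Sum>\<^sub>\<infinity>\<omega>\<in>\<Lambda>. ?h (- \<omega>))"
    by (rule lattice_infsum_uminus[symmetric])
  also have "\<dots> = (\<Sum>\<^sub>\<infinity>\<omega>\<in>\<Lambda>. ?g \<omega>)"
  proof (rule infsum_cong)
    fix \<omega>
    have "(- \<omega> - z)\<^sup>2 = (\<omega> + z)\<^sup>2" by (simp add: power2_eq_square algebra_simps)
    thus "?h (- \<omega>) = ?g \<omega>" by simp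
  qed
  finally show 2: "wp z = (\<Sum>\<^sub>\<infinity>\<omega>\<in>\<Lambda>. ?g \<omega>)" .
  show "wp z = lat_rem_sum 2 0 z" using 1 2 by simp
qed

lemma wp_minus [simp]: "wp (- z) = wp z"
proof -
  have "wp (- z) = (\<Sum>\<^sub>\<infinity>\<omega>\<in>\<Lambda>. inverse ((- \<omega> + - z)\<^sup>2) - inverse ((- \<omega>)\<^sup>2))"
    unfolding wp_eq by (rule lattice_infsum_uminus[symmetric])
  moreover have "(- \<omega> + - z)\<^sup>2 = (\<omega> + z)\<^sup>2" for \<omega> by (simp add: power2_eq_square algebra_simps)
  ultimately show ?thesis by (simp add: wp_eq)
qed

lemma wzeta_minus [simp]: "wzeta (- z) = - wzeta z"
proof -
  have "wzeta (- z) = (\<Sum>\<^sub>\<infinity>\<omega>\<in>\<Lambda>. lat_rem 1 0 (- z) (- \<omega>))"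
    unfolding wzeta_def lat_rem_sum_def by (rule lattice_infsum_uminus[symmetric])
  moreover have "lat_rem 1 0 (- z) (- \<omega>) = - lat_rem 1 0 z \<omega>" for \<omega>
  proof -
    have "- \<omega> + - z = - (\<omega> + z)" by simp
    hence "inverse (- \<omega> + - z) = - inverse (\<omega> + z)" by (metis inverse_minus_eq)
    thus ?thesis unfolding lat_rem_1 by simp
  qed
  ultimately show ?thesis by (simp add: infsum_uminus wzeta_def lat_rem_sum_def)
qed

text \<open>The difference of two values of \<open>\<wp>\<close> is a sum without convergence factors, hence
  invariant under a simultaneous translation of both arguments.\<close>

lemma wp_periodic:
  assumes \<omega>0: "\<omega>0 \<in> \<Lambda>"
  shows "wp (z + \<omega>0) = wp z"
proof -
  have diff: "wp x - wp y = (\<Sum>\<^sub>\<infinity>\<omega>\<in>\<Lambda>. inverse ((\<omega> + x)\<^sup>2) - inverse ((\<omega> + y)\<^sup>2))" for x y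
    using infsum_diff[OF wp_summable[of x] wp_summable[of y]] by (simp add: wp_eq)
  have "wp (x + \<omega>0) - wp (y + \<omega>0) = wp x - wp y" for x y
    unfolding diff
    using lattice_infsum_shift[OF \<omega>0, of "\<lambda>\<omega>. inverse ((\<omega> + x)\<^sup>2) - inverse ((\<omega> + y)\<^sup>2)"]
    by (simp add: add_ac)
  \<comment> \<open>The points -\<omega>0/2 and \<omega>0/2 differ by the period, and \<wp> agrees
    there because it is even.\<close>
  from this[of z "- \<omega>0 / 2"] wp_minus[of "\<omega>0 / 2"] show ?thesis by simp
qed

text \<open>\<open>wzeta0\<close> and \<open>wp0\<close> are the parts of \<zeta> and \<wp> regular
  at 0; they make the cancellation of poles in \<open>wzeta_sum_square\<close> explicit.\<close>

definition wzeta0 :: "complex \<Rightarrow> complex" where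
  "wzeta0 z = (\<Sum>\<^sub>\<infinity>\<omega>\<in>\<Lambda> - {0}. lat_rem 1 0 z \<omega>)"

definition wp0 :: "complex \<Rightarrow> complex" where
  "wp0 z = (\<Sum>\<^sub>\<infinity>\<omega>\<in>\<Lambda> - {0}. inverse ((\<omega> + z)\<^sup>2) - inverse (\<omega>\<^sup>2))"

lemma infsum_lattice_split:
  fixes f :: "complex \<Rightarrow> complex"
  assumes "f summable_on \<Lambda>"
  shows "infsum f \<Lambda> = f 0 + infsum f (\<Lambda> - {0})"
proof -
  have "f summable_on (\<Lambda> - {0})" using assms by (rule summable_on_subset_banach) auto
  hence "infsum f (insert 0 (\<Lambda> - {0})) = f 0 + infsum f (\<Lambda> - {0})"
    by (intro infsum_insert) auto
  moreover have "insert 0 (\<Lambda> - {0}) = \<Lambda>" by auto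
  ultimately show ?thesis by simp
qed

lemma wzeta_split: "wzeta z = inverse z + wzeta0 z"
  unfolding wzeta_def lat_rem_sum_def wzeta0_def
  by (subst infsum_lattice_split) (auto intro!: lat_rem_summable simp: lat_rem_1[simplified])

lemma wp_split: "wp z = inverse (z\<^sup>2) + wp0 z"
  unfolding wp_eq wp0_def using wp_summable by (subst infsum_lattice_split) auto

lemma wzeta0_0 [simp]: "wzeta0 0 = 0" and wp0_0 [simp]: "wp0 0 = 0"
  by (simp_all add: wzeta0_def wp0_def)

text \<open>Termwise differentiation: for z in a compact set the remainders are uniformly
  O(|\<omega>|^(-3)), with finitely many small \<omega> excepted.\<close>

lemma wzeta0_has_field_derivative:
  assumes z: "z \<notin> \<Lambda> - {0}"
  shows "(wzeta0 has_field_derivative - wp0 z) (at z)"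
proof -
  let ?S = "- (\<Lambda> - {0})"
  have S: "open ?S" by (rule open_lattice_compl) auto
  have der: "((\<lambda>z. lat_rem 1 0 z \<omega>) has_field_derivative
                - (inverse ((\<omega> + z)\<^sup>2) - inverse (\<omega>\<^sup>2))) (at z)"
    if "\<omega> \<in> \<Lambda> - {0}" "z \<in> ?S" for \<omega> z
  proof -
    have "\<omega> + z \<noteq> 0"
    proof
      assume "\<omega> + z = 0"
      hence "z = - \<omega>" by (simp add: eq_neg_iff_add_eq_0 add.commute)
      thus False using that by simp
    qed
    thus ?thesis unfolding lat_rem_1
      by (auto intro!: derivative_eq_intros simp: power2_eq_square)
  qed
  have holo: "(\<lambda>z. lat_rem 1 0 z \<omega>) holomorphic_on ?S" if "\<omega> \<in> \<Lambda> - {0}" for \<omega>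
    using der[OF that] S holomorphic_on_open by blast
  have bound: "\<exists>r>0. \<exists>M. cball x r \<subseteq> ?S \<and> M summable_on (\<Lambda> - {0}) \<and>
      finite {\<omega>\<in>\<Lambda> - {0}. \<exists>y\<in>cball x r. M \<omega> < cmod (lat_rem 1 0 y \<omega>)}" if x: "x \<in> ?S" for x
  proof -
    obtain r where r: "r > 0" "cball x r \<subseteq> ?S"
      using S x open_contains_cball by blast
    define R where "R = cmod x + r"
    \<comment> \<open>The constant of \<open>norm_lat_rem_le\<close> for k = 1, B = 0.\<close>
    define C where "C = (exp ((real 1 + 0) / 2) * 4 * (real 1 + 0)\<^sup>2 + 2 * (real 1 + 0))"
    define M where "M = (\<lambda>\<omega>. C * R\<^sup>2 * cmod \<omega> powr - 3)"
    have "(\<lambda>\<omega>. cmod \<omega> powr - 3) summable_on (\<Lambda> - {0})"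
      by (rule summable_on_subset_banach[OF lattice_summable]) auto
    hence "M summable_on (\<Lambda> - {0})"
      unfolding M_def by (intro summable_on_cmult_right)
    moreover have "finite {\<omega>\<in>\<Lambda> - {0}. \<exists>y\<in>cball x r. M \<omega> < cmod (lat_rem 1 0 y \<omega>)}"
    proof (rule finite_subset[OF _ finite_lattice_cball[of "4 * R"]], safe)
      fix \<omega> y assume \<omega>: "\<omega> \<in> \<Lambda>" "\<omega> \<noteq> 0" and y: "y \<in> cball x r"
        and less: "M \<omega> < cmod (lat_rem 1 0 y \<omega>)"
      show "cmod \<omega> \<le> 4 * R"
      proof (rule ccontr)
        assume *: "\<not> ?thesis"
        have yR: "cmod y \<le> R" unfolding R_def
          using y norm_triangle_sub[of y x] by (simp add: dist_norm norm_minus_commute)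
        have "cmod (lat_rem 1 0 y \<omega>) \<le> C * cmod y ^ 2 * cmod \<omega> powr (- real 1 - Re 0 - 2)"
          unfolding C_def using \<omega> * yR by (intro norm_lat_rem_le) auto
        also have "\<dots> \<le> C * R\<^sup>2 * cmod \<omega> powr (- real 1 - Re 0 - 2)"
          using yR by (intro mult_right_mono mult_left_mono power_mono) (auto simp: C_def)
        finally show False using less by (simp add: M_def)
      qed
    qed
    ultimately show ?thesis using r by blast
  qed
  have "((\<lambda>x. \<Sum>\<^sub>\<infinity>\<omega>\<in>\<Lambda> - {0}. lat_rem 1 0 x \<omega>) has_field_derivative
          (\<Sum>\<^sub>\<infinity>\<omega>\<in>\<Lambda> - {0}. deriv (\<lambda>z. lat_rem 1 0 z \<omega>) z)) (at z)"
    by (rule infsum_has_field_derivative[OF holo S bound]) (use z in auto)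
  also have "(\<Sum>\<^sub>\<infinity>\<omega>\<in>\<Lambda> - {0}. deriv (\<lambda>z. lat_rem 1 0 z \<omega>) z) = - wp0 z"
    unfolding wp0_def infsum_uminus[symmetric]
    by (intro infsum_cong DERIV_imp_deriv der) (use z in auto)
  finally show ?thesis by (simp add: wzeta0_def[abs_def])
qed

text \<open>Up to sign it is the derivative of a holomorphic function, so no second convergence
  estimate arises.\<close>

lemma wp0_holomorphic: "wp0 holomorphic_on - (\<Lambda> - {0})"
proof -
  have S: "open (- (\<Lambda> - {0}))" by (rule open_lattice_compl) auto
  have "wzeta0 holomorphic_on - (\<Lambda> - {0})"
    using wzeta0_has_field_derivative S holomorphic_on_open by blast
  hence "(\<lambda>z. - deriv wzeta0 z) holomorphic_on - (\<Lambda> - {0})"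
    by (intro holomorphic_intros holomorphic_deriv S)
  moreover have "- deriv wzeta0 z = wp0 z" if "z \<in> - (\<Lambda> - {0})" for z
    using DERIV_imp_deriv[OF wzeta0_has_field_derivative, of z] that by auto
  ultimately show ?thesis by (metis (no_types, lifting) holomorphic_cong)
qed

lemma wzeta_has_field_derivative:
  assumes z: "z \<notin> \<Lambda>"
  shows "(wzeta has_field_derivative - wp z) (at z)"
proof -
  have "z \<noteq> 0" using z by auto
  hence "((\<lambda>z. inverse z + wzeta0 z) has_field_derivative - inverse (z\<^sup>2) + - wp0 z) (at z)"
    using z by (intro DERIV_add wzeta0_has_field_derivative)
      (auto intro!: derivative_eq_intros simp: power2_eq_square)
  thus ?thesis by (simp add: wzeta_split[abs_def] wp_split)
qed

lemma wzeta_holomorphic: "wzeta holomorphic_on - \<Lambda>"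
  using wzeta_has_field_derivative open_lattice_compl[of \<Lambda>] holomorphic_on_open by blast

lemma wp_holomorphic: "wp holomorphic_on - \<Lambda>"
proof -
  have "(\<lambda>z. inverse (z\<^sup>2) + wp0 z) holomorphic_on - \<Lambda>"
    by (intro holomorphic_intros holomorphic_on_subset[OF wp0_holomorphic]) auto
  thus ?thesis by (simp add: wp_split)
qed

text \<open>The difference \<zeta>(z + \<omega>) - \<zeta>(z) has derivative 0 by periodicity of
  \<wp>, and the plane minus a countable set is connected.\<close>

lemma wzeta_quasiperiodic:
  obtains \<eta> where "\<And>\<omega> z. \<omega> \<in> \<Lambda> \<Longrightarrow> z \<notin> \<Lambda> \<Longrightarrow> wzeta (z + \<omega>) = wzeta z + \<eta> \<omega>"
proof -
  have conn: "connected (- \<Lambda>)"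
    using connected_open_diff_countable[of UNIV \<Lambda>] countable_lattice by (simp add: Compl_eq_Diff_UNIV connected_UNIV)
  have "\<exists>\<eta>. \<forall>z\<in>-\<Lambda>. wzeta (z + \<omega>) - wzeta z = \<eta>" if \<omega>: "\<omega> \<in> \<Lambda>" for \<omega>
  proof -
    have "(\<lambda>z. wzeta (z + \<omega>) - wzeta z) constant_on - \<Lambda>"
    proof (rule has_field_derivative_0_imp_constant_on[OF _ conn open_lattice_compl])
      fix z assume z: "z \<in> - \<Lambda>"
      have "((\<lambda>z. wzeta (z + \<omega>) - wzeta z) has_field_derivative - wp (z + \<omega>) - - wp z) (at z)"
        using z \<omega> by (intro DERIV_diff wzeta_has_field_derivative)
          (auto intro!: DERIV_chain2[OF wzeta_has_field_derivative, THEN DERIV_cong] derivative_eq_intros)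
      thus "((\<lambda>z. wzeta (z + \<omega>) - wzeta z) has_field_derivative 0) (at z)"
        by (simp add: wp_periodic[OF \<omega>])
    qed auto
    thus ?thesis by (auto simp: constant_on_def)
  qed
  then obtain \<eta> where "\<And>\<omega> z. \<omega> \<in> \<Lambda> \<Longrightarrow> z \<in> - \<Lambda> \<Longrightarrow> wzeta (z + \<omega>) - wzeta z = \<eta> \<omega>"
    by metis
  thus ?thesis by (intro that[of \<eta>]) (auto simp: algebra_simps)
qed

section \<open>Liouville's theorem and the quadratic identity for zeta\<close>

lemma lattice_reduce:
  obtains \<omega> where "\<omega> \<in> \<Lambda>" "cmod (z - \<omega>) \<le> cmod \<tau> + 1"
proof
  define x where "x = Im z / Im \<tau>"
  define y where "y = Re z - x * Re \<tau>"
  have z: "z = of_real x * \<tau> + of_real y"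
    using Im_pos by (auto simp: complex_eq_iff x_def y_def)
  let ?w = "of_int \<lfloor>x\<rfloor> * \<tau> + of_int \<lfloor>y\<rfloor>"
  show "?w \<in> \<Lambda>" unfolding period_lattice_def by blast
  have "z - ?w = of_real (frac x) * \<tau> + of_real (frac y)"
    by (simp add: z frac_def algebra_simps)
  also have "cmod \<dots> \<le> \<bar>frac x\<bar> * cmod \<tau> + \<bar>frac y\<bar>"
    by (rule order.trans[OF norm_triangle_ineq]) (simp add: norm_mult)
  also have "\<dots> \<le> 1 * cmod \<tau> + 1"
    using frac_lt_1[of x] frac_lt_1[of y] frac_ge_0[of x] frac_ge_0[of y]
    by (intro add_mono mult_right_mono) auto
  finally show "cmod (z - ?w) \<le> cmod \<tau> + 1" by simp
qed

text \<open>All values are already taken on a compact disc containing a point of every class modulo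
  the lattice.\<close>

lemma entire_periodic_constant:
  assumes "g holomorphic_on UNIV" and per: "\<And>z \<omega>. \<omega> \<in> \<Lambda> \<Longrightarrow> g (z + \<omega>) = g z"
  shows "g z = g 0"
proof -
  have "continuous_on (cball 0 (cmod \<tau> + 1)) g"
    using assms(1) holomorphic_on_imp_continuous_on continuous_on_subset by blast
  hence bdd: "bounded (g ` cball 0 (cmod \<tau> + 1))"
    by (intro compact_imp_bounded compact_continuous_image) auto
  have "range g \<subseteq> g ` cball 0 (cmod \<tau> + 1)"
  proof clarify
    fix z
    obtain \<omega> where \<omega>: "\<omega> \<in> \<Lambda>" "cmod (z - \<omega>) \<le> cmod \<tau> + 1" using lattice_reduce .
    have "g z = g (z - \<omega>)" using per[OF \<omega>(1), of "z - \<omega>"] by simp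
    thus "g z \<in> g ` cball 0 (cmod \<tau> + 1)" using \<omega>(2) by auto
  qed
  hence "bounded (range g)" using bdd bounded_subset by blast
  thus ?thesis using Liouville_theorem[OF assms(1)] by (metis UNIV_I constant_on_def)
qed

text \<open>Fix b and let z = a vary. In \<zeta>(z) - \<zeta>(z + b) the quasi-periods cancel, so
  the difference \<open>f\<close> of the two sides is elliptic, with singularities at most in
  \<Lambda> and -b + \<Lambda>. At each of them it tends to 0, so filling in 0 gives an entire
  elliptic function; it is constant and vanishes at 0.\<close>

lemma wzeta_sum_square:
  assumes a: "a \<notin> \<Lambda>" and b: "b \<notin> \<Lambda>" and ab: "a + b \<notin> \<Lambda>"
  shows "(wzeta a + wzeta b - wzeta (a + b))\<^sup>2 = wp a + wp b + wp (a + b)"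
proof -
  define f where "f = (\<lambda>z. (wzeta z + wzeta b - wzeta (z + b))\<^sup>2 - wp z - wp b - wp (z + b))"
  define P where "P = {z. z \<in> \<Lambda> \<or> z + b \<in> \<Lambda>}"
  define g where "g = (\<lambda>z. if z \<in> P then 0 else f z)"
  obtain \<eta> where \<eta>: "\<And>\<omega> z. \<omega> \<in> \<Lambda> \<Longrightarrow> z \<notin> \<Lambda> \<Longrightarrow> wzeta (z + \<omega>) = wzeta z + \<eta> \<omega>"
    using wzeta_quasiperiodic by blast
  have per: "g (z + \<omega>) = g z" if \<omega>: "\<omega> \<in> \<Lambda>" for z \<omega>
  proof -
    have eq: "z + \<omega> + b = (z + b) + \<omega>" by simp
    have P: "z + \<omega> \<in> P \<longleftrightarrow> z \<in> P" unfolding P_def mem_Collect_eq eq using \<omega> by simp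
    show ?thesis
    proof (cases "z \<in> P")
      case False
      hence "f (z + \<omega>) = f z"
        unfolding f_def eq using \<omega> by (simp add: P_def \<eta> wp_periodic add_diff_eq)
      thus ?thesis using P by (simp add: g_def)
    qed (use P in \<open>simp add: g_def\<close>)
  qed
  \<comment> \<open>The reflection z \<mapsto> -b - z exchanges the classes \<Lambda> and -b +
    \<Lambda>; with periodicity, only the singularity at 0 remains to be analysed.\<close>
  have refl: "g (- b - z) = g z" for z
  proof -
    have eq: "- b - z = - (z + b)" "- b - z + b = - z" by simp_all
    have "- b - z \<in> P \<longleftrightarrow> z \<in> P" unfolding P_def mem_Collect_eq eq(2)
      unfolding eq(1) lattice_uminus_iff by blast
    moreover have "f (- b - z) = f z"
      unfolding f_def eq(2) unfolding eq(1) wzeta_minus wp_minus by (simp add: algebra_simps)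
    ultimately show ?thesis by (simp add: g_def)
  qed
  have lim0: "(g \<longlongrightarrow> 0) (at 0)"
  proof -
    \<comment> \<open>Here 1/z + q(z) is the expression being squared, and (1/z + q)^2 - 1/z^2 = 2
      q/z + q^2. As q(0) = 0 and q'(0) = \<wp>(b), this tends to 2 \<wp>(b), which cancels against
      \<wp>(b) + \<wp>(z + b).\<close>
    define q where "q = (\<lambda>z. wzeta0 z + wzeta b - wzeta (z + b))"
    have "(q has_field_derivative - wp0 0 + 0 - - wp b) (at 0)"
      unfolding q_def using b
      by (intro DERIV_diff DERIV_add wzeta0_has_field_derivative DERIV_const)
        (auto intro!: DERIV_chain2[OF wzeta_has_field_derivative, THEN DERIV_cong] derivative_eq_intros)
    hence q': "(q has_field_derivative wp b) (at 0)" by simp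
    have q0: "q 0 = 0" by (simp add: q_def)
    have l1: "((\<lambda>z. q z / z) \<longlongrightarrow> wp b) (at 0)"
      using q' by (simp add: has_field_derivative_iff q0)
    have l2: "(q \<longlongrightarrow> 0) (at 0)"
      using DERIV_isCont[OF q'] q0 by (simp add: isCont_def)
    have S0: "open (- (\<Lambda> - {0}))" by (rule open_lattice_compl) auto
    have "continuous_on (- (\<Lambda> - {0})) wp0"
      by (rule holomorphic_on_imp_continuous_on[OF wp0_holomorphic])
    hence "isCont wp0 0" using S0 by (subst (asm) continuous_on_eq_continuous_at) auto
    hence l3: "(wp0 \<longlongrightarrow> 0) (at 0)" by (simp add: isCont_def)
    have "continuous_on (- \<Lambda>) wp"
      by (rule holomorphic_on_imp_continuous_on[OF wp_holomorphic])
    hence "isCont wp b" using open_lattice_compl[of \<Lambda>] b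
      by (subst (asm) continuous_on_eq_continuous_at) auto
    hence l4: "((\<lambda>z. wp (z + b)) \<longlongrightarrow> wp b) (at 0)"
      by (simp add: isCont_def LIM_offset_zero_iff[of b] add.commute)
    have "((\<lambda>z. 2 * (q z / z) + (q z)\<^sup>2 - wp0 z - wp b - wp (z + b)) \<longlongrightarrow>
             2 * wp b + 0\<^sup>2 - 0 - wp b - wp b) (at 0)"
      by (intro tendsto_intros l1 l2 l3 l4)
    hence "((\<lambda>z. 2 * (q z / z) + (q z)\<^sup>2 - wp0 z - wp b - wp (z + b)) \<longlongrightarrow> 0) (at 0)" by simp
    moreover have "\<forall>\<^sub>F z in at 0. 2 * (q z / z) + (q z)\<^sup>2 - wp0 z - wp b - wp (z + b) = g z"
    proof -
      have S1: "open (- (\<Lambda> - {0}) \<inter> (\<lambda>z. z + b) -` (- \<Lambda>))"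
        by (intro open_Int S0 open_vimage open_lattice_compl continuous_intros) auto
      have "\<forall>\<^sub>F z in at 0. z \<in> - (\<Lambda> - {0}) \<inter> (\<lambda>z. z + b) -` (- \<Lambda>) - {0}"
        using b by (intro eventually_at_in_open[OF S1]) auto
      thus ?thesis
      proof eventually_elim
        case (elim z)
        hence "z \<notin> P" "z \<noteq> 0" by (auto simp: P_def)
        thus ?case
          by (simp add: g_def f_def q_def wzeta_split[of z] wp_split[of z] field_simps power2_eq_square)
      qed
    qed
    ultimately show ?thesis by (rule Lim_transform_eventually)
  qed
  have limL: "(g \<longlongrightarrow> 0) (at \<omega>)" if \<omega>: "\<omega> \<in> \<Lambda>" for \<omega>
  proof -
    have "((\<lambda>z. g (\<omega> + z)) \<longlongrightarrow> 0) (at 0)"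
      using lim0 per[OF \<omega>] by (simp add: add.commute)
    thus ?thesis by (simp add: LIM_offset_zero_iff[of \<omega>])
  qed
  have lim: "(g \<longlongrightarrow> 0) (at p)" if p: "p \<in> P" for p
  proof (cases "p \<in> \<Lambda>")
    case False
    hence "- b - p \<in> \<Lambda>" using p lattice_uminus_iff[of "p + b"] by (simp add: P_def algebra_simps)
    hence 1: "(g \<longlongrightarrow> 0) (at (- b - p))" by (rule limL)
    have 2: "filterlim (\<lambda>z. - b - z) (at (- b - p)) (at p)"
      unfolding filterlim_at by (auto intro!: tendsto_eq_intros simp: eventually_at_filter)
    from filterlim_compose[OF 1 2] show ?thesis by (simp add: refl)
  qed (use limL in auto)
  have S: "open (- (P - {p}))" for p
  proof -
    have "- (P - {p}) = - (\<Lambda> - {p}) \<inter> (\<lambda>z. z + b) -` (- (\<Lambda> - {p + b}))"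
      by (auto simp: P_def)
    also have "open \<dots>"
      by (intro open_Int open_vimage open_lattice_compl continuous_intros) auto
    finally show ?thesis .
  qed
  have "f holomorphic_on - P"
  proof -
    have "(wzeta \<circ> (\<lambda>z. z + b)) holomorphic_on - P"
      by (intro holomorphic_on_compose_gen[OF _ wzeta_holomorphic] holomorphic_intros) (auto simp: P_def)
    moreover have "(wp \<circ> (\<lambda>z. z + b)) holomorphic_on - P"
      by (intro holomorphic_on_compose_gen[OF _ wp_holomorphic] holomorphic_intros) (auto simp: P_def)
    moreover have "wzeta holomorphic_on - P" "wp holomorphic_on - P"
      by (rule holomorphic_on_subset[OF wzeta_holomorphic] holomorphic_on_subset[OF wp_holomorphic];
          auto simp: P_def)+
    ultimately show ?thesis unfolding f_def o_def by (intro holomorphic_intros)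
  qed
  hence holP: "g holomorphic_on - P"
    by (rule holomorphic_cong[THEN iffD1, rotated 2]) (auto simp: g_def)
  \<comment> \<open>Riemann's theorem on removable singularities, applied to one point of
    \<open>P\<close> at a time.\<close>
  have "g holomorphic_on - (P - {p})" if p: "p \<in> P" for p
  proof (rule no_isolated_singularity'[OF _ _ S])
    show "g holomorphic_on - (P - {p}) - {p}"
      using holP by (rule holomorphic_on_subset) auto
    show "(g \<longlongrightarrow> g z) (at z within - (P - {p}))" if "z \<in> {p}" for z
      using that p lim[OF p] by (auto simp: g_def intro: tendsto_within_subset)
  qed auto
  moreover have "open (- P)" using S[of a] a ab by (simp add: P_def)
  ultimately have "g field_differentiable (at p)" for p
    using holP S[of p] holomorphic_on_imp_differentiable_at[of g "- P" p]
      holomorphic_on_imp_differentiable_at[of g "- (P - {p})" p] by blast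
  hence "g holomorphic_on UNIV"
    by (auto simp: holomorphic_on_def field_differentiable_at_within)
  hence "g a = g 0" using per by (rule entire_periodic_constant)
  thus ?thesis using a ab by (simp add: g_def P_def f_def algebra_simps)
qed

lemma half_not_in_lattice:
  fixes m n :: int
  assumes "odd m \<or> odd n"
  shows "(of_int m * \<tau> + of_int n) / 2 \<notin> \<Lambda>"
proof
  assume "(of_int m * \<tau> + of_int n) / 2 \<in> \<Lambda>"
  then obtain m' n' :: int where "(of_int m * \<tau> + of_int n) / 2 = of_int m' * \<tau> + of_int n'"
    unfolding period_lattice_def by auto
  hence eq: "of_int m * \<tau> + of_int n = of_int (2 * m') * \<tau> + of_int (2 * n')"
    by (simp add: field_simps)
  have "(m, n) = (2 * m', 2 * n')"
    using inj_onD[OF bij_betw_imp_inj_on[OF lattice_bij], of "(m, n)" "(2 * m', 2 * n')"] eq by simp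
  thus False using assms by auto
qed

text \<open>Since \<zeta>(\<omega>/2) is half the quasi-period of \<omega> and quasi-periods add,
  the square in \<open>wzeta_sum_square\<close> vanishes for a = 1/2, b = \<tau>/2.\<close>

lemma wp_half_periods: "wp (1/2) + wp (\<tau>/2) + wp ((1 + \<tau>)/2) = 0"
proof -
  obtain \<eta> where \<eta>: "\<And>\<omega> z. \<omega> \<in> \<Lambda> \<Longrightarrow> z \<notin> \<Lambda> \<Longrightarrow> wzeta (z + \<omega>) = wzeta z + \<eta> \<omega>"
    using wzeta_quasiperiodic by blast
  \<comment> \<open>Quasi-periodicity from -\<omega>/2 to \<omega>/2, combined with oddness.\<close>
  have half: "2 * wzeta (\<omega> / 2) = \<eta> \<omega>" if "\<omega> \<in> \<Lambda>" "\<omega> / 2 \<notin> \<Lambda>" for \<omega>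
    using \<eta>[OF that(1), of "- \<omega> / 2"] wzeta_minus[of "\<omega> / 2"] that(2) lattice_uminus_iff[of "\<omega> / 2"]
    by simp
  have n: "1 / 2 \<notin> \<Lambda>" "\<tau> / 2 \<notin> \<Lambda>" "(1 + \<tau>) / 2 \<notin> \<Lambda>"
    using half_not_in_lattice[of 0 1] half_not_in_lattice[of 1 0] half_not_in_lattice[of 1 1]
    by (simp_all add: add.commute)
  \<comment> \<open>Translate 1/2 by 1 + \<tau> at once, or first by 1 and then by \<tau>.\<close>
  have "\<eta> (1 + \<tau>) = \<eta> 1 + \<eta> \<tau>"
    using \<eta>[of "1 + \<tau>" "1/2"] \<eta>[of \<tau> "1/2 + 1"] \<eta>[of 1 "1/2"] n(1)
      lattice_add_cancel(1)[OF one_in_lattice, of "1/2"]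
    by (simp add: lattice_add add.assoc)
  hence "2 * (wzeta (1/2) + wzeta (\<tau>/2) - wzeta ((1 + \<tau>)/2)) = 0"
    using half[of 1] half[of \<tau>] half[of "1 + \<tau>"] n by (simp add: lattice_add algebra_simps)
  hence "wzeta (1/2) + wzeta (\<tau>/2) - wzeta ((1 + \<tau>)/2) = 0"
    by (metis mult_eq_0_iff zero_neq_numeral)
  hence "wzeta (1/2) + wzeta (\<tau>/2) - wzeta (1/2 + \<tau>/2) = 0"
    by (simp only: add_divide_distrib)
  thus ?thesis
    using wzeta_sum_square[of "1/2" "\<tau>/2"] n by (simp add: add_divide_distrib)
qed

section \<open>Analytic continuation\<close>

lemma lat_term_div_cnj_summable:
  assumes "real k + Re \<sigma> > 1"
  shows "(\<lambda>\<omega>. lat_term k \<sigma> \<omega> / cnj \<omega>) summable_on \<Lambda>"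
proof (rule abs_summable_summable, rule Infinite_Sum.abs_summable_on_comparison_test')
  show "(\<lambda>\<omega>. cmod \<omega> powr - (real k + Re \<sigma> + 1)) summable_on \<Lambda>"
    using assms by (intro lattice_summable) auto
  show "norm (lat_term k \<sigma> \<omega> / cnj \<omega>) \<le> cmod \<omega> powr - (real k + Re \<sigma> + 1)" for \<omega>
    by (cases "\<omega> = 0") (simp_all add: norm_lat_term norm_divide powr_diff)
qed

text \<open>In this half-plane the remainder and each Taylor term are separately summable. The
  formula isolates the only parts that still need continuation: the sums independent of z.\<close>

lemma has_sum_lat_term_shift:
  assumes \<sigma>: "real k + Re \<sigma> > 2"
  shows "((\<lambda>\<omega>. lat_term k \<sigma> (\<omega> + z)) has_sum
     lat_rem_sum k \<sigma> z + infsum (lat_term k \<sigma>) \<Lambda>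
       - (of_nat k + \<sigma> / 2) * z * infsum (lat_term (Suc k) \<sigma>) \<Lambda>
       - \<sigma> / 2 * cnj z * (\<Sum>\<^sub>\<infinity>\<omega>\<in>\<Lambda>. lat_term k \<sigma> \<omega> / cnj \<omega>)) \<Lambda>"
proof -
  let ?A = "\<lambda>\<omega>. lat_term k \<sigma> \<omega>" and ?B = "\<lambda>\<omega>. lat_term (Suc k) \<sigma> \<omega>"
    and ?C = "\<lambda>\<omega>. lat_term k \<sigma> \<omega> / cnj \<omega>"
  have eq: "lat_term k \<sigma> (\<omega> + z) = lat_rem k \<sigma> z \<omega> + ?A \<omega> + - ((of_nat k + \<sigma> / 2) * z) * ?B \<omega>
              + - (\<sigma> / 2 * cnj z) * ?C \<omega>" for \<omega>
  proof -
    have "?B \<omega> = ?A \<omega> / \<omega>" by (simp add: lat_term_def field_simps)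
    thus ?thesis unfolding lat_rem_def by (simp add: algebra_simps)
  qed
  have 1: "((\<lambda>\<omega>. lat_rem k \<sigma> z \<omega>) has_sum lat_rem_sum k \<sigma> z) \<Lambda>"
    unfolding lat_rem_sum_def using \<sigma> by (intro has_sum_infsum lat_rem_summable) auto
  have 2: "(?A has_sum infsum ?A \<Lambda>) \<Lambda>" using \<sigma> by (intro has_sum_infsum lat_term_summable)
  have 3: "(?B has_sum infsum ?B \<Lambda>) \<Lambda>" using \<sigma> by (intro has_sum_infsum lat_term_summable) auto
  have 4: "(?C has_sum infsum ?C \<Lambda>) \<Lambda>"
    using \<sigma> by (intro has_sum_infsum lat_term_div_cnj_summable) auto
  have "((\<lambda>\<omega>. lat_term k \<sigma> (\<omega> + z)) has_sum
     lat_rem_sum k \<sigma> z + infsum ?A \<Lambda> + - ((of_nat k + \<sigma> / 2) * z) * infsum ?B \<Lambda>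
       + - (\<sigma> / 2 * cnj z) * infsum ?C \<Lambda>) \<Lambda>"
    unfolding eq by (intro has_sum_add has_sum_cmult_right 1 2 3 4)
  thus ?thesis by (simp add: algebra_simps)
qed

section \<open>Functional equation and continuation of homogeneous lattice sums\<close>

definition coset_reps :: "nat \<Rightarrow> complex set" where
  "coset_reps N = (\<lambda>(a, b). of_int a * \<tau> + of_int b) ` ({0..<int N} \<times> {0..<int N})"

lemma finite_coset_reps [simp]: "finite (coset_reps N)"
  by (simp add: coset_reps_def)

lemma card_coset_reps: "card (coset_reps N) = N\<^sup>2"
  unfolding coset_reps_def
  by (subst card_image[OF inj_on_subset[OF bij_betw_imp_inj_on[OF lattice_bij]]])
     (auto simp: power2_eq_square)

text \<open>Division with remainder by N in both coordinates writes \<Lambda> as the disjoint union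
  of the sets N\<Lambda> + c.\<close>

lemma has_sum_lattice_cosets:
  fixes f :: "complex \<Rightarrow> complex"
  assumes N: "N > 0" and S: "\<And>c. c \<in> coset_reps N \<Longrightarrow> ((\<lambda>\<omega>. f (of_nat N * \<omega> + c)) has_sum S c) \<Lambda>"
  shows "(f has_sum (\<Sum>c\<in>coset_reps N. S c)) \<Lambda>"
proof -
  define B where "B = (\<lambda>c. (\<lambda>\<omega>. of_nat N * \<omega> + c) ` \<Lambda>)"
  have inj: "inj_on (\<lambda>\<omega>. of_nat N * \<omega> + c) \<Lambda>" for c :: complex
    using N by (auto simp: inj_on_def)
  have "(f has_sum (\<Sum>c\<in>coset_reps N. S c)) (\<Union>c\<in>coset_reps N. B c)"
  proof (rule sum_has_sum)
    show "(f has_sum S c) (B c)" if "c \<in> coset_reps N" for c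
      unfolding B_def using S[OF that] by (subst has_sum_reindex[OF inj]) (simp add: o_def)
    show "B c \<inter> B c' = {}" if c: "c \<in> coset_reps N" "c' \<in> coset_reps N" "c \<noteq> c'" for c c'
    proof (rule ccontr)
      assume "B c \<inter> B c' \<noteq> {}"
      then obtain \<omega> \<omega>' where \<omega>: "\<omega> \<in> \<Lambda>" "\<omega>' \<in> \<Lambda>" "of_nat N * \<omega> + c = of_nat N * \<omega>' + c'"
        unfolding B_def by blast
      obtain m n m' n' :: int where mn: "\<omega> = of_int m * \<tau> + of_int n" "\<omega>' = of_int m' * \<tau> + of_int n'"
        using \<omega> unfolding period_lattice_def by blast
      obtain a b a' b' :: int where ab: "c = of_int a * \<tau> + of_int b" "c' = of_int a' * \<tau> + of_int b'"
         and ran: "a \<in> {0..<int N}" "b \<in> {0..<int N}" "a' \<in> {0..<int N}" "b' \<in> {0..<int N}"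
        using c unfolding coset_reps_def by auto
      have "of_int (int N * m + a) * \<tau> + of_int (int N * n + b) =
            of_int (int N * m' + a') * \<tau> + of_int (int N * n' + b')"
        using \<omega>(3) by (simp add: mn ab algebra_simps)
      hence "int N * m + a = int N * m' + a'" "int N * n + b = int N * n' + b'"
        using inj_onD[OF bij_betw_imp_inj_on[OF lattice_bij],
            of "(int N * m + a, int N * n + b)" "(int N * m' + a', int N * n' + b')"] by simp_all
      hence "(int N * m + a) mod int N = (int N * m' + a') mod int N"
        "(int N * n + b) mod int N = (int N * n' + b') mod int N" by simp_all
      hence "a = a'" "b = b'" using ran by simp_all
      thus False using ab c(3) by simp
    qed
  qed auto
  also have "(\<Union>c\<in>coset_reps N. B c) = \<Lambda>"
  proof (rule antisym)
    show "(\<Union>c\<in>coset_reps N. B c) \<subseteq> \<Lambda>"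
    proof clarify
      fix x c assume c: "c \<in> coset_reps N" and "x \<in> B c"
      then obtain \<omega> where \<omega>: "\<omega> \<in> \<Lambda>" "x = of_nat N * \<omega> + c" unfolding B_def by blast
      obtain m n :: int where mn: "\<omega> = of_int m * \<tau> + of_int n"
        using \<omega> unfolding period_lattice_def by blast
      obtain a b :: int where ab: "c = of_int a * \<tau> + of_int b"
        using c unfolding coset_reps_def by auto
      have "x = of_int (int N * m + a) * \<tau> + of_int (int N * n + b)"
        using \<omega>(2) by (simp add: mn ab algebra_simps)
      thus "x \<in> \<Lambda>" unfolding period_lattice_def by blast
    qed
    show "\<Lambda> \<subseteq> (\<Union>c\<in>coset_reps N. B c)"
    proof
      fix x assume "x \<in> \<Lambda>"
      then obtain m n :: int where mn: "x = of_int m * \<tau> + of_int n"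
        unfolding period_lattice_def by blast
      define c \<omega> where "c = of_int (m mod int N) * \<tau> + of_int (n mod int N)"
        and "\<omega> = of_int (m div int N) * \<tau> + of_int (n div int N)"
      have c: "c \<in> coset_reps N" unfolding c_def coset_reps_def using N
        by (intro image_eqI[of _ _ "(m mod int N, n mod int N)"]) auto
      have "\<omega> \<in> \<Lambda>" unfolding \<omega>_def period_lattice_def by blast
      moreover have "x = of_int (int N * (m div int N) + m mod int N) * \<tau>
                         + of_int (int N * (n div int N) + n mod int N)"
        by (simp only: mn mult_div_mod_eq)
      hence "x = of_nat N * \<omega> + c"
        unfolding c_def \<omega>_def by (simp only: of_int_add of_int_mult) (simp add: algebra_simps)
      ultimately have "x \<in> B c" unfolding B_def by blast
      thus "x \<in> (\<Union>c\<in>coset_reps N. B c)" using c by blast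
    qed
  qed
  finally show ?thesis .
qed

text \<open>The exponent is normalised so that the summand has absolute value |\<omega>|^(-2 - Re s)
  for every k: k = 2 gives the sum of \<omega>^(-2) |\<omega>|^(-s), k = 0 that of
  |\<omega>|^(-2-s).\<close>

definition lat_sum :: "nat \<Rightarrow> complex \<Rightarrow> complex" where
  "lat_sum k s = (\<Sum>\<^sub>\<infinity>\<omega>\<in>\<Lambda>. lat_term k (2 - of_nat k + s) \<omega>)"

definition coset_rem_sum :: "nat \<Rightarrow> nat \<Rightarrow> complex \<Rightarrow> complex" where
  "coset_rem_sum k N s = (\<Sum>c\<in>coset_reps N. lat_rem_sum k (2 - of_nat k + s) (c / of_nat N)) / of_nat N ^ 2"

lemma lat_term_of_nat:
  assumes "N > 0"
  shows "lat_term k \<sigma> (of_nat N) = of_nat N powr (- of_nat k - \<sigma>)"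
proof -
  have "inverse (of_nat N ^ k) = (of_nat N :: complex) powr (- of_nat k)"
    using assms by (simp add: powr_minus powr_nat)
  thus ?thesis using assms by (simp add: lat_term_def flip: powr_add)
qed

text \<open>Splitting \<open>\<Lambda>\<close> into cosets of \<open>N\<Lambda>\<close> gives a functional equation for the sum of a homogeneous
  function: the terms of order zero reproduce the sum itself, those of order one cancel by parity.\<close>

lemma lat_sum_scaling:
  assumes s: "Re s > 0" and N: "N > 0" and k: "even k"
  shows "(of_nat N powr s - 1) * lat_sum k s = coset_rem_sum k N s"
proof -
  define \<sigma> where "\<sigma> = 2 - of_nat k + s"
  define q where "q = lat_term k \<sigma> (of_nat N)"
  have \<sigma>: "real k + Re \<sigma> > 2" using s by (simp add: \<sigma>_def)
  have odd1: "infsum (lat_term (Suc k) \<sigma>) \<Lambda> = 0"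
    by (rule lattice_infsum_odd) (use k in \<open>simp add: lat_term_uminus\<close>)
  have odd2: "(\<Sum>\<^sub>\<infinity>\<omega>\<in>\<Lambda>. lat_term k \<sigma> \<omega> / cnj \<omega>) = 0"
    by (rule lattice_infsum_odd) (use k in \<open>simp add: lat_term_uminus\<close>)
  have K: "lat_sum k s = infsum (lat_term k \<sigma>) \<Lambda>" by (simp add: lat_sum_def \<sigma>_def)
  have "(lat_term k \<sigma> has_sum (\<Sum>c\<in>coset_reps N. q * (lat_rem_sum k \<sigma> (c / of_nat N) + lat_sum k s))) \<Lambda>"
  proof (rule has_sum_lattice_cosets[OF N])
    fix c assume "c \<in> coset_reps N"
    have "((\<lambda>\<omega>. lat_term k \<sigma> (\<omega> + c / of_nat N)) has_sum
            (lat_rem_sum k \<sigma> (c / of_nat N) + lat_sum k s)) \<Lambda>"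
      using has_sum_lat_term_shift[OF \<sigma>, of "c / of_nat N"] by (simp add: odd1 odd2 K)
    hence "((\<lambda>\<omega>. q * lat_term k \<sigma> (\<omega> + c / of_nat N)) has_sum
            q * (lat_rem_sum k \<sigma> (c / of_nat N) + lat_sum k s)) \<Lambda>"
      by (rule has_sum_cmult_right)
    also have "(\<lambda>\<omega>. q * lat_term k \<sigma> (\<omega> + c / of_nat N)) = (\<lambda>\<omega>. lat_term k \<sigma> (of_nat N * \<omega> + c))"
      unfolding q_def lat_term_mult[symmetric] using N by (simp add: distrib_left)
    finally show "((\<lambda>\<omega>. lat_term k \<sigma> (of_nat N * \<omega> + c)) has_sum
            q * (lat_rem_sum k \<sigma> (c / of_nat N) + lat_sum k s)) \<Lambda>" .
  qed
  hence "lat_sum k s = (\<Sum>c\<in>coset_reps N. q * (lat_rem_sum k \<sigma> (c / of_nat N) + lat_sum k s))"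
    by (simp add: K infsumI)
  also have "\<dots> = q * ((\<Sum>c\<in>coset_reps N. lat_rem_sum k \<sigma> (c / of_nat N)) + of_nat N ^ 2 * lat_sum k s)"
    by (simp add: card_coset_reps sum.distrib flip: sum_distrib_left)
  also have "(\<Sum>c\<in>coset_reps N. lat_rem_sum k \<sigma> (c / of_nat N)) = of_nat N ^ 2 * coset_rem_sum k N s"
    using N by (simp add: coset_rem_sum_def \<sigma>_def)
  also have "q * (of_nat N ^ 2 * coset_rem_sum k N s + of_nat N ^ 2 * lat_sum k s) =
               (q * of_nat N ^ 2) * (coset_rem_sum k N s + lat_sum k s)" by (simp add: algebra_simps)
  \<comment> \<open>By homogeneity q = N^(-2-s), and the N^2 cosets compensate the factor
    N^(-2).\<close>
  also have "q * of_nat N ^ 2 = of_nat N powr (- s)"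
  proof -
    have q: "q = of_nat N powr (- 2 - s)"
      unfolding q_def lat_term_of_nat[OF N] by (simp add: \<sigma>_def)
    have "q * of_nat N ^ 2 = of_nat N powr (- 2 - s) * of_nat N powr 2"
      using N by (simp add: q powr_nat')
    also have "\<dots> = of_nat N powr (- s)" by (subst powr_add[symmetric]) simp
    finally show ?thesis .
  qed
  finally have "of_nat N powr s * lat_sum k s =
      (of_nat N powr s * of_nat N powr (- s)) * (coset_rem_sum k N s + lat_sum k s)"
    by (metis mult.assoc)
  also have "of_nat N powr s * of_nat N powr (- s) = 1" using N by (simp flip: powr_add)
  finally show ?thesis by (simp add: algebra_simps)
qed

text \<open>The substitution \<sigma> = 2 - k + s turns the half-plane Re \<sigma> > -k of
  \<open>holomorphic_lat_rem_sum\<close> into Re s > -2.\<close>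

lemma coset_rem_sum_holomorphic: "coset_rem_sum k N holomorphic_on {s. Re s > -2}"
proof -
  have "(\<lambda>s. lat_rem_sum k (2 - of_nat k + s) z) holomorphic_on {s. Re s > -2}" for z
  proof -
    have "((\<lambda>\<sigma>. lat_rem_sum k \<sigma> z) \<circ> (\<lambda>s. 2 - of_nat k + s)) holomorphic_on {s. Re s > -2}"
      by (rule holomorphic_on_compose_gen[OF _ holomorphic_lat_rem_sum]) (auto intro!: holomorphic_intros)
    thus ?thesis by (simp add: o_def)
  qed
  thus ?thesis unfolding coset_rem_sum_def[abs_def] by (cases "N = 0") (auto intro!: holomorphic_intros)
qed

text \<open>Put e_N(s) = (N^s - 1)/s, extended by ln N at 0. By \<open>lat_sum_scaling\<close>, s
  times the lattice sum is \<open>coset_rem_sum\<close> divided by e_N. Since e_2 and e_3 have no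
  common zero, the quotients for N = 2 and N = 3 glue to a holomorphic \<open>G\<close>. The last
  claim records the residue of the lattice sum at s = 0, up to the factor ln 2.\<close>

lemma lat_sum_continuation:
  assumes k: "even k"
  obtains G where "G holomorphic_on {s. Re s > -2}" "\<And>s. Re s > 1 \<Longrightarrow> G s = s * lat_sum k s"
    "of_real (ln 2) * G 0 = coset_rem_sum k 2 0"
proof -
  let ?U = "{s::complex. Re s > -2}"
  have U: "open ?U" by (rule open_halfspace_Re_gt)
  \<comment> \<open>A difference quotient at 0 with the derivative filled in, the form in which
    \<open>pole_lemma_open\<close> gives holomorphy.\<close>
  define e :: "nat \<Rightarrow> complex \<Rightarrow> complex" where
    "e = (\<lambda>N s. if s = 0 then deriv (\<lambda>s. of_nat N powr s) 0 else (of_nat N powr s - of_nat N powr 0) / (s - 0))"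
  have pw: "((\<lambda>s. of_nat N powr s) has_field_derivative of_real (ln (real N)) * of_nat N powr s) (at s)"
    if "N > 0" for N :: nat and s :: complex
    using that by (auto intro!: derivative_eq_intros simp: Ln_of_nat mult_ac)
  have holpw: "(\<lambda>s. of_nat N powr s) holomorphic_on ?U" if "N > 0" for N :: nat
    using pw[OF that] U holomorphic_on_open by blast
  have e_holo: "e N holomorphic_on ?U" if "N > 0" for N
    unfolding e_def by (rule pole_lemma_open[OF holpw[OF that] U])
  have e0: "e N 0 = of_real (ln (real N))" if "N > 0" for N
    using DERIV_imp_deriv[OF pw[OF that, of 0]] that by (simp add: e_def)
  have e_mult: "s * e N s = of_nat N powr s - 1" if "N > 0" for N s
    using that by (simp add: e_def)
  have e_nz: "e 2 s \<noteq> 0 \<or> e 3 s \<noteq> 0" for s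
  proof (cases "s = 0")
    case True
    thus ?thesis by (simp add: e0)
  next
    case False
    thus ?thesis using e_mult[of 2 s] e_mult[of 3 s] two_three_powr_common_period[of s] by auto
  qed
  have eK: "e N s * (s * lat_sum k s) = coset_rem_sum k N s" if "Re s > 1" "N > 0" for s N
  proof -
    have "e N s * (s * lat_sum k s) = (s * e N s) * lat_sum k s" by (simp add: mult_ac)
    thus ?thesis using lat_sum_scaling[of s N k] e_mult[of N s] that k by simp
  qed
  \<comment> \<open>Agreement of the two quotients, cross-multiplied to avoid dividing by zeros; it
    extends from Re s > 1 by the identity theorem.\<close>
  have cross: "e 2 s * coset_rem_sum k 3 s = e 3 s * coset_rem_sum k 2 s" if s: "s \<in> ?U" for s
  proof (rule analytic_continuation_open[of "{s. Re s > 1}" ?U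
        "\<lambda>s. e 2 s * coset_rem_sum k 3 s" "\<lambda>s. e 3 s * coset_rem_sum k 2 s"])
    show "open {s. 1 < Re s}" by (rule open_halfspace_Re_gt)
    show "{s. 1 < Re s} \<noteq> {}" by (auto intro: exI[of _ 2])
    show "connected ?U" by (intro convex_connected convex_halfspace_Re_gt)
    show "(\<lambda>s. e 2 s * coset_rem_sum k 3 s) holomorphic_on ?U" "(\<lambda>s. e 3 s * coset_rem_sum k 2 s) holomorphic_on ?U"
      by (intro holomorphic_intros e_holo coset_rem_sum_holomorphic; simp)+
    show "e 2 z * coset_rem_sum k 3 z = e 3 z * coset_rem_sum k 2 z" if "z \<in> {s. 1 < Re s}" for z
    proof -
      have "coset_rem_sum k 2 z = e 2 z * (z * lat_sum k z)" "coset_rem_sum k 3 z = e 3 z * (z * lat_sum k z)"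
        using that eK[of z 2] eK[of z 3] by simp_all
      thus ?thesis by (simp only: mult_ac)
    qed
  qed (use U s in auto)
  define G where "G = (\<lambda>s. if e 2 s \<noteq> 0 then coset_rem_sum k 2 s / e 2 s else coset_rem_sum k 3 s / e 3 s)"
  have eG: "e N s * G s = coset_rem_sum k N s" if "s \<in> ?U" "N = 2 \<or> N = 3" for s N
    using cross[OF that(1)] e_nz[of s] that(2) by (auto simp: G_def field_simps)
  show ?thesis
  proof
    show "G holomorphic_on ?U"
    proof -
      \<comment> \<open>By \<open>eG\<close>, near a point with \<open>e N s \<noteq> 0\<close> the
        function \<open>G\<close> is the quotient for this N, whichever case of its definition
        applies.\<close>
      have loc: "G field_differentiable (at s)" if s: "s \<in> ?U" and N: "N = 2 \<or> N = 3" and nz: "e N s \<noteq> 0" for s N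
      proof -
        have N0: "N > 0" using N by auto
        define V where "V = {x\<in>?U. e N x \<noteq> 0}"
        have "V = ?U \<inter> e N -` (- {0})" by (auto simp: V_def)
        also have "open \<dots>"
          by (rule continuous_open_preimage[OF holomorphic_on_imp_continuous_on[OF e_holo[OF N0]] U]) auto
        finally have V: "open V" .
        have "(\<lambda>x. coset_rem_sum k N x / e N x) holomorphic_on V"
          by (intro holomorphic_intros holomorphic_on_subset[OF e_holo[OF N0]]
              holomorphic_on_subset[OF coset_rem_sum_holomorphic]) (auto simp: V_def)
        hence "G holomorphic_on V"
          by (rule holomorphic_cong[THEN iffD1, rotated 2])
             (use eG[OF _ N] in \<open>auto simp: V_def field_simps\<close>)
        thus ?thesis using V s nz by (auto intro: holomorphic_on_imp_differentiable_at simp: V_def)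
      qed
      have "G field_differentiable (at s)" if "s \<in> ?U" for s
        using e_nz[of s] loc[OF that, of 2] loc[OF that, of 3] by blast
      thus ?thesis by (simp add: holomorphic_on_def field_differentiable_at_within)
    qed
    show "G s = s * lat_sum k s" if s: "Re s > 1" for s
      using e_nz[of s] eK[OF s, of 2] eK[OF s, of 3] eG[of s 2] eG[of s 3] s
      by (metis (no_types, lifting) mult_left_cancel mem_Collect_eq less_trans zero_less_numeral
            neg_less_0_iff_less zero_less_one)
    show "of_real (ln 2) * G 0 = coset_rem_sum k 2 0"
      using eG[of 0 2] e0[of 2] by simp
  qed
qed

lemma coset_reps_2: "coset_reps 2 = {0, 1, \<tau>, 1 + \<tau>}"
proof -
  have "{0..<int 2} = {0, 1}" by auto
  thus ?thesis unfolding coset_reps_def by (auto simp: image_iff add.commute)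
qed

text \<open>For k = 2, s = 0 the remainder sums are values of \<wp>, taken at the halves of the
  coset representatives: the coset of 0 contributes 0, the others the three half-periods.\<close>

lemma coset_rem_sum_2_2_0: "coset_rem_sum 2 2 0 = 0"
proof -
  have "card (coset_reps 2) = 4" by (simp add: card_coset_reps)
  \<comment> \<open>Having four elements, the set in \<open>coset_reps_2\<close> cannot contain a
    repetition.\<close>
  hence dist: "distinct [0, 1, \<tau>, 1 + \<tau>]"
    unfolding coset_reps_2 by (intro card_distinct) simp
  have "lat_rem_sum 2 0 0 = 0" by (simp add: lat_rem_sum_def)
  thus ?thesis
    using dist wp_half_periods by (simp add: coset_rem_sum_def coset_reps_2 wp_eq_lat_rem_sum add.assoc)
qed

text \<open>For Re s > 1 the series is expanded by \<open>has_sum_lat_term_shift\<close> with k = 1: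
  the order-zero sum is odd and vanishes, and the two first-order sums are the cases k = 2 and k = 0
  of \<open>lat_sum\<close>. Their continuations do not involve z, hence neither do \<open>a\<close>
  and \<open>b\<close>; the remainder at s = 0 is \<zeta>.\<close>

lemma phi1_eq_wzeta:
  obtains a b where "\<And>z. z \<notin> \<Lambda> \<Longrightarrow> phi1 z \<tau> = wzeta z - a * z - b * cnj z"
proof -
  let ?U = "{s::complex. Re s > -2}"
  have U: "open ?U" by (rule open_halfspace_Re_gt)
  obtain G0 where G0: "G0 holomorphic_on ?U" "\<And>s. Re s > 1 \<Longrightarrow> G0 s = s * lat_sum 0 s"
    using lat_sum_continuation[of 0] by auto
  obtain G2 where G2: "G2 holomorphic_on ?U" "\<And>s. Re s > 1 \<Longrightarrow> G2 s = s * lat_sum 2 s"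
    "of_real (ln 2) * G2 0 = coset_rem_sum 2 2 0"
    using lat_sum_continuation[of 2] by auto
  have G20: "G2 0 = 0" using G2(3) coset_rem_sum_2_2_0 by simp
  \<comment> \<open>\<open>G2\<close> vanishes at 0, so dividing it by s introduces no pole; this
    continues the sum of \<omega>^(-2) |\<omega>|^(-s) through s = 0.\<close>
  define K2 where "K2 = (\<lambda>s. if s = 0 then deriv G2 0 else (G2 s - G2 0) / (s - 0))"
  have K2: "K2 holomorphic_on ?U" unfolding K2_def by (rule pole_lemma_open[OF G2(1) U])
  have K2_eq: "K2 s = lat_sum 2 s" if "Re s > 1" for s
    using that G2(2)[OF that] by (auto simp: K2_def G20)
  have "phi1 z \<tau> = wzeta z - K2 0 * z - G0 0 / 2 * cnj z" if z: "z \<notin> \<Lambda>" for z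
  proof -
    define F where "F = (\<lambda>s. lat_rem_sum 1 s z - (1 + s / 2) * z * K2 s - G0 s / 2 * cnj z)"
    have holo: "F holomorphic_on {s. Re s > -1}"
      unfolding F_def using holomorphic_lat_rem_sum[of 1 z]
      by (intro holomorphic_intros holomorphic_on_subset[OF K2] holomorphic_on_subset[OF G0(1)]) auto
    have series: "F s = phi1_series z \<tau> s" if s: "Re s > 1" for s
    proof -
      have odd: "infsum (lat_term 1 s) \<Lambda> = 0"
        by (rule lattice_infsum_odd) (simp add: lat_term_uminus)
      have 2: "infsum (lat_term (Suc 1) s) \<Lambda> = K2 s"
        using K2_eq[OF s] by (simp add: lat_sum_def numeral_2_eq_2)
      \<comment> \<open>As \<omega> cnj \<omega> = |\<omega>|^2, this is the radial sum; its
        prefactor s matches the one in \<open>G0\<close>.\<close>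
      have "lat_term 1 s \<omega> / cnj \<omega> = lat_term 0 (2 + s) \<omega>" for \<omega>
      proof (cases "\<omega> = 0")
        case False
        have "inverse (\<omega> * cnj \<omega>) = of_real (cmod \<omega>) powr (- 2)"
          using False by (simp add: complex_norm_square[symmetric] powr_minus powr_nat')
        moreover have "lat_term 1 s \<omega> / cnj \<omega> = inverse (\<omega> * cnj \<omega>) * of_real (cmod \<omega>) powr (- s)"
          by (simp add: lat_term_def field_simps)
        ultimately have "lat_term 1 s \<omega> / cnj \<omega> =
            of_real (cmod \<omega>) powr (- 2) * of_real (cmod \<omega>) powr (- s)" by (simp only:)
        also have "\<dots> = lat_term 0 (2 + s) \<omega>"
          by (simp add: lat_term_def flip: powr_add)
        finally show ?thesis .
      qed auto
      hence 3: "s * (\<Sum>\<^sub>\<infinity>\<omega>\<in>\<Lambda>. lat_term 1 s \<omega> / cnj \<omega>) = G0 s"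
        using G0(2)[OF s] by (simp add: lat_sum_def)
      have "\<Lambda> - {- z} = \<Lambda>" using z lattice_uminus_iff[of z] by blast
      hence "phi1_series z \<tau> s = (\<Sum>\<^sub>\<infinity>\<omega>\<in>\<Lambda>. lat_term 1 s (\<omega> + z))"
        by (simp add: phi1_series_def lat_term_def add.commute)
      also have "\<dots> = lat_rem_sum 1 s z + infsum (lat_term 1 s) \<Lambda>
         - (of_nat 1 + s / 2) * z * infsum (lat_term (Suc 1) s) \<Lambda>
         - s / 2 * cnj z * (\<Sum>\<^sub>\<infinity>\<omega>\<in>\<Lambda>. lat_term 1 s \<omega> / cnj \<omega>)"
        using s by (intro infsumI has_sum_lat_term_shift) auto
      also have "\<dots> = F s"
        unfolding odd 2 F_def 3[symmetric] by simp
      finally show ?thesis by simp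
    qed
    have "phi1_continuation z \<tau> (-1) F"
      unfolding phi1_continuation_def using holo series by auto
    hence "phi1 z \<tau> = F 0" by (rule phi1_eqI) simp
    thus ?thesis by (simp add: F_def wzeta_def mult_ac)
  qed
  thus ?thesis using that by blast
qed

end

section \<open>Taylor expansions\<close>

lemma wirtinger_cong:
  assumes S: "open S" "z \<in> S" and eq: "\<And>w. w \<in> S \<Longrightarrow> f w = g w"
  shows "wirtinger f z = wirtinger g z"
proof -
  have "vector_derivative (\<lambda>t. f (z + c * of_real t)) (at 0) =
        vector_derivative (\<lambda>t. g (z + c * of_real t)) (at 0)" for c :: complex
  proof (rule vector_derivative_cong_eq)
    have "open ((\<lambda>t::real. z + c * of_real t) -` S)"
      by (intro open_vimage S continuous_intros)
    hence "\<forall>\<^sub>F t in nhds 0. t \<in> (\<lambda>t::real. z + c * of_real t) -` S"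
      using S by (intro eventually_nhds_in_open) auto
    thus "\<forall>\<^sub>F t in nhds 0. t \<in> UNIV \<longrightarrow> f (z + c * of_real t) = g (z + c * of_real t)"
      by eventually_elim (use eq in auto)
  qed auto
  from this[of 1] this[of \<i>] show ?thesis by (simp add: wirtinger_def)
qed

text \<open>The derivative in direction c is c D - b cnj c; combining c = 1 with -\<i> times c =
  \<i> gives 2 D and eliminates b.\<close>

lemma wirtinger_holomorphic_minus_cnj:
  assumes f: "(f has_field_derivative D) (at z)"
  shows "wirtinger (\<lambda>w. f w - b * cnj w) z = D"
proof -
  have "vector_derivative (\<lambda>t. f (z + c * of_real t) - b * cnj (z + c * of_real t)) (at 0)
          = c * D - b * cnj c" for c :: complex
  proof (rule vector_derivative_at)
    have "((\<lambda>t. z + c * of_real t) has_vector_derivative c) (at 0)"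
      by (auto intro!: derivative_eq_intros)
    hence "((f \<circ> (\<lambda>t. z + c * of_real t)) has_vector_derivative c * D) (at 0)"
      by (rule field_vector_diff_chain_at) (use f in simp)
    moreover have "((\<lambda>t. b * cnj (z + c * of_real t)) has_vector_derivative b * cnj c) (at 0)"
      by (auto intro!: derivative_eq_intros)
    ultimately show "((\<lambda>t. f (z + c * of_real t) - b * cnj (z + c * of_real t))
        has_vector_derivative (c * D - b * cnj c)) (at 0)"
      by (auto simp: o_def intro: has_vector_derivative_diff)
  qed
  from this[of 1] this[of \<i>] show ?thesis
    by (simp add: wirtinger_def algebra_simps)
qed

text \<open>One derivative already removes the conjugate, so it affects only the constant Taylor
  coefficient.\<close>

lemma wirtinger_iterate:
  assumes S: "open S" and f: "f holomorphic_on S" and h: "\<And>w. w \<in> S \<Longrightarrow> h w = f w - b * cnj w"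
    and z: "z \<in> S"
  shows "(wirtinger ^^ n) h z = (deriv ^^ n) f z - (if n = 0 then b else 0) * cnj z"
  using z
proof (induction n arbitrary: z)
  case (Suc n)
  have "(wirtinger ^^ Suc n) h z = wirtinger (\<lambda>w. (deriv ^^ n) f w - (if n = 0 then b else 0) * cnj w) z"
    using wirtinger_cong[OF S Suc.prems Suc.IH] by simp
  also have "\<dots> = deriv ((deriv ^^ n) f) z"
    by (intro wirtinger_holomorphic_minus_cnj holomorphic_derivI[OF holomorphic_higher_deriv[OF f S] S Suc.prems])
  finally show ?case by simp
qed (simp add: h)

lemma Tay_eq_fps_expansion:
  assumes "open S" "f holomorphic_on S" "\<And>w. w \<in> S \<Longrightarrow> h w \<tau> = f w - b * cnj w" "z \<in> S"
  shows "Tay z h \<tau> = fps_expansion f z - fps_const (b * cnj z)"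
  using wirtinger_iterate[where h = "\<lambda>w. h w \<tau>", OF assms]
  by (auto simp: fps_eq_iff Tay_def fps_expansion_def diff_divide_distrib)

section \<open>Coefficients of the three substitutions\<close>

lemma fps2_subst_nth:
  "fps2_subst f G $ j $ i = (\<Sum>n=0..i+j. f $ n * (G ^ n) $ j $ i)"
  by (simp add: fps2_subst_def)

lemma fps2_subst_minus_const:
  "fps2_subst (f - fps_const c) G = fps2_subst f G - fps_const (fps_const c)"
proof -
  have "(\<Sum>n=0..i+j. (f - fps_const c) $ n * (G ^ n) $ j $ i) =
        (\<Sum>n=0..i+j. f $ n * (G ^ n) $ j $ i) - fps_const (fps_const c) $ j $ i" for i j
  proof -
    have "(\<Sum>n=0..i+j. (f - fps_const c) $ n * (G ^ n) $ j $ i) =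
          (\<Sum>n=0..i+j. f $ n * (G ^ n) $ j $ i) - (\<Sum>n=0..i+j. if n = 0 then c * (1 $ j $ i) else 0)"
      unfolding sum_subtractf[symmetric] by (intro sum.cong) (auto simp: algebra_simps)
    also have "(\<Sum>n=0..i+j. if n = 0 then c * (1 $ j $ i) else 0) = fps_const (fps_const c) $ j $ i"
      by (simp add: sum.delta)
    finally show ?thesis .
  qed
  thus ?thesis by (simp add: fps_eq_iff fps2_subst_nth)
qed

lemma fps2_subst_X: "fps2_subst f fps2_X $ j = (if j = 0 then f else 0)"
proof -
  have "(\<Sum>n=0..i+j. f $ n * (fps2_X ^ n) $ j $ i) = (if j = 0 then f $ i else 0)" for i
  proof -
    have "(\<Sum>n=0..i+j. f $ n * (fps2_X ^ n) $ j $ i) = (\<Sum>n=0..i+j. if n = i then (if j = 0 then f $ i else 0) else 0)"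
      by (intro sum.cong) (auto simp: fps2_X_def fps_const_power fps_X_power_nth)
    also have "\<dots> = (if j = 0 then f $ i else 0)" by (simp add: sum.delta)
    finally show ?thesis .
  qed
  thus ?thesis by (simp add: fps_eq_iff fps2_subst_nth)
qed

lemma fps2_subst_Y: "fps2_subst f fps2_Y $ j = fps_const (f $ j)"
proof -
  have "(\<Sum>n=0..i+j. f $ n * (fps2_Y ^ n) $ j $ i) = fps_const (f $ j) $ i" for i
  proof -
    have "(\<Sum>n=0..i+j. f $ n * (fps2_Y ^ n) $ j $ i) = (\<Sum>n=0..i+j. if n = j then (if i = 0 then f $ j else 0) else 0)"
      by (intro sum.cong) (auto simp: fps2_Y_def fps_X_power_nth)
    also have "\<dots> = fps_const (f $ j) $ i" by (simp add: sum.delta)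
    finally show ?thesis .
  qed
  thus ?thesis by (simp add: fps_eq_iff fps2_subst_nth)
qed

text \<open>The binomial theorem coefficientwise; the induction step is Pascal's rule.\<close>

lemma fps2_minus_X_minus_Y_power:
  "((- fps2_X - fps2_Y) ^ n) $ j $ i = (if i + j = n then (-1) ^ n * of_nat (n choose i) else 0)"
proof (induction n arbitrary: i j)
  case 0
  thus ?case by auto
next
  case (Suc n)
  let ?H = "(- fps2_X - fps2_Y) ^ n"
  have "((- fps2_X - fps2_Y) ^ Suc n) = - (fps_const fps_X * ?H) - fps_X * ?H"
    by (simp add: fps2_X_def fps2_Y_def algebra_simps)
  hence "((- fps2_X - fps2_Y) ^ Suc n) $ j $ i =
      - (if i = 0 then 0 else ?H $ j $ (i - 1)) - (if j = 0 then 0 else ?H $ (j - 1) $ i)"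
    by simp
  also have "\<dots> = (if i + j = Suc n then (-1) ^ Suc n * of_nat (Suc n choose i) else 0)"
    unfolding Suc.IH by (cases i; cases j) (auto simp: binomial_eq_0 algebra_simps)
  finally show ?case .
qed

lemma fps2_subst_minus_X_minus_Y:
  "fps2_subst f (- fps2_X - fps2_Y) $ j $ i = (-1) ^ (i + j) * of_nat ((i + j) choose i) * f $ (i + j)"
proof -
  have "fps2_subst f (- fps2_X - fps2_Y) $ j $ i =
     (\<Sum>n=0..i+j. if n = i + j then (-1) ^ (i + j) * of_nat ((i + j) choose i) * f $ (i + j) else 0)"
    unfolding fps2_subst_nth fps2_minus_X_minus_Y_power by (intro sum.cong) auto
  thus ?thesis by (simp add: sum.delta)
qed

section \<open>Iterated expansion in two variables\<close>

lemma has_fps_expansion_reflect: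
  assumes S: "open S" and f: "f holomorphic_on S" and w: "w \<in> S"
  shows "(\<lambda>y. f (w - y)) has_fps_expansion Abs_fps (\<lambda>n. (-1) ^ n * (deriv ^^ n) f w / fact n)"
proof -
  define T where "T = (\<lambda>y. w - y) -` S"
  have T: "open T" unfolding T_def by (intro open_vimage S continuous_intros)
  have 0: "0 \<in> T" using w by (simp add: T_def)
  have "(f \<circ> (\<lambda>y. w - y)) holomorphic_on T"
    by (rule holomorphic_on_compose_gen[OF _ f]) (auto simp: T_def intro!: holomorphic_intros)
  hence "(\<lambda>y. f (w - y)) has_fps_expansion fps_expansion (\<lambda>y. f (w - y)) 0"
    by (intro has_fps_expansion_fps_expansion[OF T 0]) (simp add: o_def)
  also have "fps_expansion (\<lambda>y. f (w - y)) 0 = Abs_fps (\<lambda>n. (-1) ^ n * (deriv ^^ n) f w / fact n)"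
    using higher_deriv_compose_linear'[OF f T S 0, of "-1" w]
    by (simp add: fps_expansion_def fps_eq_iff T_def)
  finally show ?thesis .
qed

text \<open>Expanding \<open>f(z\<^sub>1 + x) + f(z\<^sub>2 + y) + f(z\<^sub>3 - x - y)\<close> first in \<open>y\<close> and then the coefficients
  in \<open>x\<close> matches the representation of \<open>\<complex>[[X,Y]]\<close> as \<open>\<complex>[[X]][[Y]]\<close>.\<close>

definition Y_coeff :: "(complex \<Rightarrow> complex) \<Rightarrow> complex \<Rightarrow> complex \<Rightarrow> complex \<Rightarrow> nat \<Rightarrow> complex \<Rightarrow> complex" where
  "Y_coeff f z1 z2 z3 j x = (if j = 0 then f (z1 + x) else 0) + (deriv ^^ j) f z2 / fact j
      + (-1) ^ j / fact j * (deriv ^^ j) f (z3 - x)"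

lemma has_fps_expansion_Y:
  assumes S: "open S" and f: "f holomorphic_on S" and z: "z2 \<in> S" "z3 - x \<in> S"
  shows "(\<lambda>y. f (z1 + x) + f (z2 + y) + f (z3 - x - y)) has_fps_expansion
           Abs_fps (\<lambda>j. Y_coeff f z1 z2 z3 j x)"
proof -
  have "f analytic_on {z2}" using S f z analytic_at by blast
  hence "(\<lambda>y. f (z1 + x) + f (z2 + y) + f (z3 - x - y)) has_fps_expansion
     fps_const (f (z1 + x)) + fps_expansion f z2
       + Abs_fps (\<lambda>n. (-1) ^ n * (deriv ^^ n) f (z3 - x) / fact n)"
    by (intro has_fps_expansion_add has_fps_expansion_const analytic_at_imp_has_fps_expansion
        has_fps_expansion_reflect[OF S f z(2)])
  also have "fps_const (f (z1 + x)) + fps_expansion f z2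
       + Abs_fps (\<lambda>n. (-1) ^ n * (deriv ^^ n) f (z3 - x) / fact n) = Abs_fps (\<lambda>j. Y_coeff f z1 z2 z3 j x)"
    by (auto simp: fps_eq_iff Y_coeff_def fps_expansion_def)
  finally show ?thesis .
qed

text \<open>In the third summand, expanding the j-th derivative at z3 - x in x gives (-1)^(i+j)
  times the (i+j)-th derivative at z3 over i! j!, which equals the formal coefficient since
  binom(i+j, i) / (i+j)! = 1 / (i! j!).\<close>

lemma Y_coeff_has_fps_expansion:
  assumes S: "open S" and f: "f holomorphic_on S" and z: "z1 \<in> S" "z3 \<in> S"
  shows "Y_coeff f z1 z2 z3 j has_fps_expansion
     (fps2_subst (fps_expansion f z1) fps2_X + fps2_subst (fps_expansion f z2) fps2_Y
       + fps2_subst (fps_expansion f z3) (- fps2_X - fps2_Y)) $ j"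
proof -
  have "f analytic_on {z1}" using S f z analytic_at by blast
  hence 1: "(\<lambda>x. if j = 0 then f (z1 + x) else 0) has_fps_expansion (if j = 0 then fps_expansion f z1 else 0)"
    by (cases "j = 0") (auto intro: analytic_at_imp_has_fps_expansion)
  have fj: "(deriv ^^ j) f holomorphic_on S" by (rule holomorphic_higher_deriv[OF f S])
  have "Y_coeff f z1 z2 z3 j has_fps_expansion
     (if j = 0 then fps_expansion f z1 else 0) + fps_const ((deriv ^^ j) f z2 / fact j)
     + fps_const ((-1) ^ j / fact j) * Abs_fps (\<lambda>n. (-1) ^ n * (deriv ^^ n) ((deriv ^^ j) f) z3 / fact n)"
    unfolding Y_coeff_def
    by (intro has_fps_expansion_add has_fps_expansion_const 1 has_fps_expansion_cmult_left
        has_fps_expansion_reflect[OF S fj z(2)])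
  also have "\<dots> = (fps2_subst (fps_expansion f z1) fps2_X + fps2_subst (fps_expansion f z2) fps2_Y
       + fps2_subst (fps_expansion f z3) (- fps2_X - fps2_Y)) $ j"
  proof -
    have "fps_const ((-1) ^ j / fact j) * Abs_fps (\<lambda>n. (-1) ^ n * (deriv ^^ n) ((deriv ^^ j) f) z3 / fact n)
        = fps2_subst (fps_expansion f z3) (- fps2_X - fps2_Y) $ j"
    proof (rule fps_ext)
      fix i
      have "of_nat ((i + j) choose i) / (fact (i + j) :: complex) = 1 / (fact i * fact j)"
        by (simp add: binomial_fact)
      thus "(fps_const ((-1) ^ j / fact j) *
            Abs_fps (\<lambda>n. (-1) ^ n * (deriv ^^ n) ((deriv ^^ j) f) z3 / fact n)) $ i =
         fps2_subst (fps_expansion f z3) (- fps2_X - fps2_Y) $ j $ i"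
        by (simp add: fps2_subst_minus_X_minus_Y fps_expansion_def power_add funpow_add field_simps)
    qed
    thus ?thesis by (simp add: fps2_subst_X fps2_subst_Y fps_expansion_def)
  qed
  finally show ?thesis .
qed

text \<open>Uniqueness of power series is used twice: for fixed small x, comparing expansions in y
  yields identities between the functions \<open>Y_coeff\<close> of x; expanding these in x yields
  the identities of formal coefficients. The square becomes a Cauchy product in Y.\<close>

lemma fps2_square_identity:
  assumes S: "open S" and f: "f holomorphic_on S" and p: "p holomorphic_on S"
    and id: "\<And>a b c. a \<in> S \<Longrightarrow> b \<in> S \<Longrightarrow> c \<in> S \<Longrightarrow> a + b + c = 0 \<Longrightarrow> (f a + f b + f c)\<^sup>2 = p a + p b + p c"
    and z: "z1 \<in> S" "z2 \<in> S" "z3 \<in> S" "z1 + z2 + z3 = 0"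
  shows "(fps2_subst (fps_expansion f z1) fps2_X + fps2_subst (fps_expansion f z2) fps2_Y
            + fps2_subst (fps_expansion f z3) (- fps2_X - fps2_Y))\<^sup>2
       = fps2_subst (fps_expansion p z1) fps2_X + fps2_subst (fps_expansion p z2) fps2_Y
            + fps2_subst (fps_expansion p z3) (- fps2_X - fps2_Y)" (is "?A\<^sup>2 = ?B")
proof (rule fps_ext)
  fix j
  have ev: "\<forall>\<^sub>F x in nhds 0. z1 + x \<in> S \<and> z3 - x \<in> S"
  proof -
    have "open ((\<lambda>x. z1 + x) -` S \<inter> (\<lambda>x. z3 - x) -` S)"
      by (intro open_Int open_vimage S continuous_intros)
    hence "\<forall>\<^sub>F x in nhds 0. x \<in> (\<lambda>x. z1 + x) -` S \<inter> (\<lambda>x. z3 - x) -` S"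
      using z by (intro eventually_nhds_in_open) auto
    thus ?thesis by simp
  qed
  have eq: "(\<Sum>i=0..j. Y_coeff f z1 z2 z3 i x * Y_coeff f z1 z2 z3 (j - i) x) = Y_coeff p z1 z2 z3 j x"
    if x: "z1 + x \<in> S" "z3 - x \<in> S" for x
  proof -
    have ev2: "\<forall>\<^sub>F y in nhds 0. z2 + y \<in> S \<and> z3 - x - y \<in> S"
    proof -
      have "open ((\<lambda>y. z2 + y) -` S \<inter> (\<lambda>y. z3 - x - y) -` S)"
        by (intro open_Int open_vimage S continuous_intros)
      hence "\<forall>\<^sub>F y in nhds 0. y \<in> (\<lambda>y. z2 + y) -` S \<inter> (\<lambda>y. z3 - x - y) -` S"
        using z x by (intro eventually_nhds_in_open) auto
      thus ?thesis by simp
    qed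
    let ?F = "Abs_fps (\<lambda>j. Y_coeff f z1 z2 z3 j x)"
    let ?f = "\<lambda>y. f (z1 + x) + f (z2 + y) + f (z3 - x - y)"
    let ?p = "\<lambda>y. p (z1 + x) + p (z2 + y) + p (z3 - x - y)"
    have sq: "(\<lambda>y. ?f y * ?f y) has_fps_expansion ?F * ?F"
      by (intro has_fps_expansion_mult has_fps_expansion_Y[OF S f] z x)
    have sq_eq: "\<forall>\<^sub>F y in nhds 0. ?f y * ?f y = ?p y"
      using ev2
    proof eventually_elim
      case (elim y)
      have "(z1 + x) + (z2 + y) + (z3 - x - y) = 0" using z(4) by (simp add: algebra_simps)
      from id[OF x(1) _ _ this] elim show ?case by (simp add: power2_eq_square)
    qed
    have "?p has_fps_expansion ?F * ?F"
      by (rule iffD1[OF has_fps_expansion_cong[OF sq_eq refl] sq])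
    moreover have "?p has_fps_expansion Abs_fps (\<lambda>j. Y_coeff p z1 z2 z3 j x)"
      by (intro has_fps_expansion_Y[OF S p] z x)
    ultimately have "?F * ?F = Abs_fps (\<lambda>j. Y_coeff p z1 z2 z3 j x)"
      by (rule fps_expansion_unique_complex)
    hence "(?F * ?F) $ j = Y_coeff p z1 z2 z3 j x" by simp
    thus ?thesis by (simp add: fps_mult_nth)
  qed
  have "(\<lambda>x. \<Sum>i=0..j. Y_coeff f z1 z2 z3 i x * Y_coeff f z1 z2 z3 (j - i) x)
          has_fps_expansion (\<Sum>i=0..j. ?A $ i * ?A $ (j - i))"
    by (intro has_fps_expansion_sum has_fps_expansion_mult Y_coeff_has_fps_expansion[OF S f] z)
  also have "(\<Sum>i=0..j. ?A $ i * ?A $ (j - i)) = ?A\<^sup>2 $ j"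
    by (simp only: power2_eq_square fps_mult_nth)
  finally have "Y_coeff p z1 z2 z3 j has_fps_expansion ?A\<^sup>2 $ j"
    using has_fps_expansion_cong[OF eventually_mono[OF ev], of
      "\<lambda>x. \<Sum>i=0..j. Y_coeff f z1 z2 z3 i x * Y_coeff f z1 z2 z3 (j - i) x" "Y_coeff p z1 z2 z3 j"] eq
    by blast
  moreover have "Y_coeff p z1 z2 z3 j has_fps_expansion ?B $ j"
    by (rule Y_coeff_has_fps_expansion[OF S p z(1) z(3)])
  ultimately show "?A\<^sup>2 $ j = ?B $ j" by (rule fps_expansion_unique_complex)
qed

section \<open>Passage from zeta to \<open>phi1\<close>\<close>

theorem theorem3p1:
  fixes \<tau> z1 z2 z3 :: complex
  assumes "Im \<tau> > 0"
    and "z1 \<notin> period_lattice \<tau>" "z2 \<notin> period_lattice \<tau>" "z3 \<notin> period_lattice \<tau>"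
    and "z1 + z2 + z3 = 0"
  shows "(fps2_subst (Tay z1 phi1 \<tau>) fps2_X + fps2_subst (Tay z2 phi1 \<tau>) fps2_Y
            + fps2_subst (Tay z3 phi1 \<tau>) (- fps2_X - fps2_Y))\<^sup>2
       = fps2_subst (Tay z1 weierstrass_p \<tau>) fps2_X + fps2_subst (Tay z2 weierstrass_p \<tau>) fps2_Y
            + fps2_subst (Tay z3 weierstrass_p \<tau>) (- fps2_X - fps2_Y)"
proof -
  interpret period_half_plane \<tau> by standard (rule assms(1))
  let ?S = "- period_lattice \<tau>"
  have S: "open ?S" by (rule open_lattice_compl) auto
  have z: "z1 \<in> ?S" "z2 \<in> ?S" "z3 \<in> ?S" using assms by auto
  obtain a b where ab: "\<And>z. z \<notin> period_lattice \<tau> \<Longrightarrow> phi1 z \<tau> = wzeta z - a * z - b * cnj z"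
    using phi1_eq_wzeta by blast
  \<comment> \<open>The holomorphic part of \<open>phi1\<close>. Its linear term drops out of f u +
    f v + f w when u + v + w = 0, so \<open>f\<close> satisfies the same quadratic identity as
    \<zeta>.\<close>
  define f where "f = (\<lambda>z. wzeta z - a * z)"
  have f: "f holomorphic_on ?S" unfolding f_def by (intro holomorphic_intros wzeta_holomorphic)
  have "(f u + f v + f w)\<^sup>2 = wp u + wp v + wp w"
    if "u \<in> ?S" "v \<in> ?S" "w \<in> ?S" "u + v + w = 0" for u v w
  proof -
    have w: "w = - (u + v)" using that(4) by (metis add_eq_0_iff)
    have uv: "u + v \<notin> period_lattice \<tau>" using that(3) unfolding w by (simp del: minus_add_distrib)
    have "f u + f v + f w = wzeta u + wzeta v - wzeta (u + v)"
      unfolding f_def w wzeta_minus by (simp add: algebra_simps)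
    thus ?thesis
      unfolding w wp_minus using wzeta_sum_square[of u v] that uv by simp
  qed
  hence main: "(fps2_subst (fps_expansion f z1) fps2_X + fps2_subst (fps_expansion f z2) fps2_Y
            + fps2_subst (fps_expansion f z3) (- fps2_X - fps2_Y))\<^sup>2
       = fps2_subst (fps_expansion wp z1) fps2_X + fps2_subst (fps_expansion wp z2) fps2_Y
            + fps2_subst (fps_expansion wp z3) (- fps2_X - fps2_Y)"
    by (intro fps2_square_identity[OF S f wp_holomorphic _ z assms(5)])
  have phi: "Tay z phi1 \<tau> = fps_expansion f z - fps_const (b * cnj z)" if "z \<in> ?S" for z
    by (rule Tay_eq_fps_expansion[OF S f _ that]) (simp add: ab f_def)
  have wp: "Tay z weierstrass_p \<tau> = fps_expansion wp z" if "z \<in> ?S" for z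
    using Tay_eq_fps_expansion[OF S wp_holomorphic _ that, of weierstrass_p \<tau> 0] by simp
  \<comment> \<open>The conjugate parts survive only as these constants, and they add up to b times
    the conjugate of z1 + z2 + z3 = 0.\<close>
  let ?c = "\<lambda>z. fps_const (fps_const (b * cnj z)) :: complex fps fps"
  have "?c z1 + ?c z2 + ?c z3 = fps_const (fps_const (b * cnj (z1 + z2 + z3)))"
    by (simp add: algebra_simps)
  also have "\<dots> = 0" unfolding assms(5) by simp
  finally have c: "?c z1 + ?c z2 + ?c z3 = 0" .
  have "(A - ?c z1) + (B - ?c z2) + (C - ?c z3) = A + B + C" for A B C
  proof -
    have "(A - ?c z1) + (B - ?c z2) + (C - ?c z3) = A + B + C - (?c z1 + ?c z2 + ?c z3)"
      by (simp only: algebra_simps)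
    thus ?thesis by (simp only: c diff_zero)
  qed
  thus ?thesis
    using main by (simp only: phi[OF z(1)] phi[OF z(2)] phi[OF z(3)] wp[OF z(1)] wp[OF z(2)] wp[OF z(3)]
        fps2_subst_minus_const)
qed

end
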